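(* For every language $L\subseteq\Sigma^*$ recognized by a 2D1CA, there exists a simple 2R1CA $M'$ which recognizes $L$ with no error: every $x\in L$ is accepted by $M'$ with probability $1$ and every $x\in\Sigma^*\setminus L$ is rejected by $M'$ with probability $1$.
   Context: Let $\Sigma$ be a finite alphabet, $\Gamma=\Sigma\cup\{\cent,\$\}$ with end-markers $\cent,\$\notin\Sigma$, $S=\{0,1\}$, $\mathrm{sign}(k)=0$ if $k=0$ and $1$ otherwise, and $\mu(\leftarrow)=-1,\mu(\downarrow)=0,\mu(\rightarrow)=+1$. 2D1CA: $M=(Q,\Sigma,\delta,q_0,Q_{\rm acc},Q_{\rm rej})$ with finite $Q$, initial state $q_0$, disjoint $Q_{\rm acc},Q_{\rm rej}\subset Q$, and $\delta:Q\times\Gamma\times S\to Q\times\{-1,0,+1\}\times\{\leftarrow,\downarrow,\rightarrow\}$. On input $x$ of length $n$ the circular tape holds $w_x=\cent x\$$ at positions $0,\dots,n+1$ (modulo $n+2$); start in $q_0$, counter $0$, head at $0$; from (state $q$, counter $a$, head $b$), if $\delta(q,w_x(b),\mathrm{sign}(a))=(q',c,d)$ go to $(q',a+c,b+\mu(d))$; halt upon entering $Q_{\rm acc}$ (accept) or $Q_{\rm rej}$ (reject). $M$ recognizes $L$ if on every input it halts, accepting iff $x\in L$. 2Q1CA: $M=(Q,\Sigma,\delta,q_0,Q_{\rm acc},Q_{\rm rej})$ with finite $Q$, $q_0\in Q$, disjoint $Q_{\rm acc},Q_{\rm rej}\subset Q$, and $\delta:Q\times\Gamma\times S\times Q\times\{-1,0,+1\}\times\{\leftarrow,\downarrow,\rightarrow\}\to\mathbb{C}$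 satisfying the well-formedness conditions below. For $\alpha,\beta\in\{-2,\dots,2\}$ let $W_{\alpha,\beta}(q_1,\sigma_1,s_1;q_2,\sigma_2,s_2)=\sum_{q'\in Q}\sum\overline{\delta(q_1,\sigma_1,s_1,q',c_1,d_1)}\,\delta(q_2,\sigma_2,s_2,q',c_2,d_2)$, inner sum over $(c_1,d_1),(c_2,d_2)$ with $c_2-c_1=\alpha$, $\mu(d_2)-\mu(d_1)=\beta$. Well-formedness: for all $q_1,q_2\in Q$, $\sigma,\sigma_1,\sigma_2\in\Gamma$, $s,s_1,s_2\in S$: (i) $W_{0,0}(q_1,\sigma,s;q_2,\sigma,s)=[q_1=q_2]$; (ii) $W_{0,\beta}(q_1,\sigma_1,s;q_2,\sigma_2,s)=0$ for $\beta\in\{1,2\}$; (iii) $W_{\alpha,0}(q_1,\sigma,s_1;q_2,\sigma,s_2)=0$ for $\alpha\in\{1,2\}$; (iv) $W_{\alpha,\beta}(q_1,\sigma_1,s_1;q_2,\sigma_2,s_2)=0$ for $\alpha\in\{1,2\}$, $\beta\in\{-2,-1,1,2\}$. On input $x$ of length $n$, configurations are $(q,a,b)\in Q\times\mathbb{Z}\times\{0,\dots,n+1\}$ and $U_x|q,a,b\rangle=\sum_{q',c,d}\delta(q,w_x(b),\mathrm{sign}(a),q',c,d)|q',a+c,b+\mu(d)\rangle$. Computation starts in $|q_0,0,0\rangle$; at each step $U_x$ is applied and then the state is measured w.r.t. the orthogonal decomposition into the spans of configurations whose state lies in $Q_{\rm acc}$, in $Q_{\rm rej}$, and in neither; outcomes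 "accept"/"reject" halt, otherwise the computation continues from the collapsed (renormalized) state. Acceptance (rejection) probability is the total probability of ever obtaining the outcome "accept" ("reject"). A 2R1CA is a 2Q1CA all of whose transition amplitudes $\delta(\cdot)$ lie in $\{0,1\}$. A 2Q1CA (or 2R1CA) is simple if there are linear operators $V_{\sigma,s}$ on $\ell_2(Q)$, a counter function $C:Q\times\Gamma\to\{-1,0,+1\}$ and a head function $D:Q\to\{\leftarrow,\downarrow,\rightarrow\}$ with $\delta(q,\sigma,s,q',c,d)=\langle q'|V_{\sigma,s}|q\rangle$ if $C(q',\sigma)=c$ and $D(q')=d$, and $0$ otherwise. *)

theory Defs
  imports "HOL-Analysis.Analysis"
begin

datatype 'a tsym = Cent | Dollar | Sym 'a

datatype dir = Lft | Stay | Rgt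

definition dirs :: "dir set" where "dirs = {Lft, Stay, Rgt}"

fun mu :: "dir \<Rightarrow> int" where
  "mu Lft = -1" | "mu Stay = 0" | "mu Rgt = 1"

definition sgnc :: "int \<Rightarrow> nat" where
  "sgnc k = (if k = 0 then 0 else 1)"

definition incs :: "int set" where "incs = {-1, 0, 1}"

definition tape :: "'a list \<Rightarrow> nat \<Rightarrow> 'a tsym" where
  "tape x b = (if b = 0 then Cent else if b = length x + 1 then Dollar else Sym (x ! (b - 1)))"

definition move :: "'a list \<Rightarrow> nat \<Rightarrow> int \<Rightarrow> nat" where
  "move x b m = nat ((int b + m) mod int (length x + 2))"

record ('q, 'a) dca =
  dstates :: "'q set"
  dinit :: 'q
  dacc :: "'q set"
  drej :: "'q set"
  dtrans :: "'q \<Rightarrow> 'a tsym \<Rightarrow> nat \<Rightarrow> 'q \<times> int \<times> dir"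

definition valid_dca :: "('q, 'a) dca \<Rightarrow> bool" where
  "valid_dca M \<longleftrightarrow> finite (dstates M) \<and> dinit M \<in> dstates M
     \<and> dacc M \<subseteq> dstates M \<and> drej M \<subseteq> dstates M \<and> dacc M \<inter> drej M = {}
     \<and> (\<forall>q\<in>dstates M. \<forall>\<sigma> s. s \<in> {0,1} \<longrightarrow>
          (case dtrans M q \<sigma> s of (q', c, d) \<Rightarrow> q' \<in> dstates M \<and> c \<in> incs))"

definition dstep :: "('q, 'a) dca \<Rightarrow> 'a list \<Rightarrow> 'q \<times> int \<times> nat \<Rightarrow> 'q \<times> int \<times> nat" where
  "dstep M x cf = (case cf of (q, a, b) \<Rightarrow>
     (case dtrans M q (tape x b) (sgnc a) of (q', c, d) \<Rightarrow> (q', a + c, move x b (mu d))))"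

definition dconf :: "('q, 'a) dca \<Rightarrow> 'a list \<Rightarrow> nat \<Rightarrow> 'q \<times> int \<times> nat" where
  "dconf M x t = (dstep M x ^^ t) (dinit M, 0, 0)"

definition dhalted_at :: "('q, 'a) dca \<Rightarrow> 'a list \<Rightarrow> nat \<Rightarrow> bool" where
  "dhalted_at M x t \<longleftrightarrow> t \<ge> 1 \<and> fst (dconf M x t) \<in> dacc M \<union> drej M"

definition dca_recognizes :: "('q, 'a) dca \<Rightarrow> 'a list set \<Rightarrow> bool" where
  "dca_recognizes M L \<longleftrightarrow> (\<forall>x. (\<exists>t. dhalted_at M x t) \<and>
      (x \<in> L \<longleftrightarrow> fst (dconf M x (LEAST t. dhalted_at M x t)) \<in> dacc M))"

record ('q, 'a) qca =
  qstates :: "'q set"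
  qinit :: 'q
  qacc :: "'q set"
  qrej :: "'q set"
  qtrans :: "'q \<Rightarrow> 'a tsym \<Rightarrow> nat \<Rightarrow> 'q \<Rightarrow> int \<Rightarrow> dir \<Rightarrow> complex"

definition W :: "('q, 'a) qca \<Rightarrow> int \<Rightarrow> int \<Rightarrow> 'q \<Rightarrow> 'a tsym \<Rightarrow> nat \<Rightarrow> 'q \<Rightarrow> 'a tsym \<Rightarrow> nat \<Rightarrow> complex" where
  "W M \<alpha> \<beta> q1 \<sigma>1 s1 q2 \<sigma>2 s2 =
     (\<Sum>q'\<in>qstates M. \<Sum>(c1, d1)\<in>incs \<times> dirs. \<Sum>(c2, d2)\<in>incs \<times> dirs.
        if c2 - c1 = \<alpha> \<and> mu d2 - mu d1 = \<beta>
        then cnj (qtrans M q1 \<sigma>1 s1 q' c1 d1) * qtrans M q2 \<sigma>2 s2 q' c2 d2 else 0)"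

definition well_formed :: "('q, 'a) qca \<Rightarrow> bool" where
  "well_formed M \<longleftrightarrow>
     (\<forall>q1\<in>qstates M. \<forall>q2\<in>qstates M.
       (\<forall>\<sigma> s. s \<in> {0,1} \<longrightarrow> W M 0 0 q1 \<sigma> s q2 \<sigma> s = (if q1 = q2 then 1 else 0))
     \<and> (\<forall>\<sigma>1 \<sigma>2 s \<beta>. s \<in> {0,1} \<and> \<beta> \<in> {1,2} \<longrightarrow> W M 0 \<beta> q1 \<sigma>1 s q2 \<sigma>2 s = 0)
     \<and> (\<forall>\<sigma> s1 s2 \<alpha>. s1 \<in> {0,1} \<and> s2 \<in> {0,1} \<and> \<alpha> \<in> {1,2} \<longrightarrow> W M \<alpha> 0 q1 \<sigma> s1 q2 \<sigma> s2 = 0)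
     \<and> (\<forall>\<sigma>1 \<sigma>2 s1 s2 \<alpha> \<beta>. s1 \<in> {0,1} \<and> s2 \<in> {0,1} \<and> \<alpha> \<in> {1,2} \<and> \<beta> \<in> {-2,-1,1,2}
           \<longrightarrow> W M \<alpha> \<beta> q1 \<sigma>1 s1 q2 \<sigma>2 s2 = 0))"

definition valid_qca :: "('q, 'a) qca \<Rightarrow> bool" where
  "valid_qca M \<longleftrightarrow> finite (qstates M) \<and> qinit M \<in> qstates M
     \<and> qacc M \<subseteq> qstates M \<and> qrej M \<subseteq> qstates M \<and> qacc M \<inter> qrej M = {}
     \<and> well_formed M"

text \<open>Vectors over configurations (q, a, b); the operator U_x, written via its matrix
  entries: the coefficient of |q',a',b'> in U_x psi collects all source configurations
  (q, a'-c, b) with (b + mu d) mod (n+2) = b'.\<close>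
type_synonym 'q qvec = "'q \<times> int \<times> nat \<Rightarrow> complex"

definition Ux :: "('q, 'a) qca \<Rightarrow> 'a list \<Rightarrow> 'q qvec \<Rightarrow> 'q qvec" where
  "Ux M x \<psi> = (\<lambda>(q', a', b').
     if q' \<in> qstates M \<and> b' \<le> length x + 1 then
       (\<Sum>q\<in>qstates M. \<Sum>c\<in>incs. \<Sum>d\<in>dirs.
          (let b = move x b' (- mu d) in
             \<psi> (q, a' - c, b) * qtrans M q (tape x b) (sgnc (a' - c)) q' c d))
     else 0)"

definition proj :: "'q set \<Rightarrow> 'q qvec \<Rightarrow> 'q qvec" where
  "proj S \<psi> = (\<lambda>(q, a, b). if q \<in> S then \<psi> (q, a, b) else 0)"

definition normsq :: "'q qvec \<Rightarrow> real" where
  "normsq \<psi> = infsum (\<lambda>cf. (cmod (\<psi> cf))\<^sup>2) UNIV"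

text \<open>Unnormalised state after t steps conditioned on no halting outcome so far.\<close>
primrec qvec_at :: "('q, 'a) qca \<Rightarrow> 'a list \<Rightarrow> nat \<Rightarrow> 'q qvec" where
  "qvec_at M x 0 = (\<lambda>cf. if cf = (qinit M, 0, 0) then 1 else 0)"
| "qvec_at M x (Suc t) = proj (- (qacc M \<union> qrej M)) (Ux M x (qvec_at M x t))"

text \<open>Probability of obtaining outcome accept (reject) at step t+1.\<close>
definition acc_step :: "('q, 'a) qca \<Rightarrow> 'a list \<Rightarrow> nat \<Rightarrow> real" where
  "acc_step M x t = normsq (proj (qacc M) (Ux M x (qvec_at M x t)))"

definition rej_step :: "('q, 'a) qca \<Rightarrow> 'a list \<Rightarrow> nat \<Rightarrow> real" where
  "rej_step M x t = normsq (proj (qrej M) (Ux M x (qvec_at M x t)))"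

definition is_2R1CA :: "('q, 'a) qca \<Rightarrow> bool" where
  "is_2R1CA M \<longleftrightarrow> valid_qca M \<and>
     (\<forall>q\<in>qstates M. \<forall>\<sigma> s q' c d. s \<in> {0,1} \<and> q' \<in> qstates M \<and> c \<in> incs \<and> d \<in> dirs
        \<longrightarrow> qtrans M q \<sigma> s q' c d \<in> {0, 1})"

definition is_simple :: "('q, 'a) qca \<Rightarrow> bool" where
  "is_simple M \<longleftrightarrow> (\<exists>(V :: 'a tsym \<Rightarrow> nat \<Rightarrow> 'q \<Rightarrow> 'q \<Rightarrow> complex) C D.
     (\<forall>q' \<sigma>. C q' \<sigma> \<in> incs) \<and>
     (\<forall>q\<in>qstates M. \<forall>\<sigma> s q' c d. s \<in> {0,1} \<and> q' \<in> qstates M \<and> c \<in> incs \<and> d \<in> dirs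
        \<longrightarrow> qtrans M q \<sigma> s q' c d = (if C q' \<sigma> = c \<and> D q' = d then V \<sigma> s q' q else 0)))"

end

theory Submission
  imports Defs
begin

text \<open>
  The classical way to make a deterministic machine reversible (Lange, McKenzie, Tapp) is to walk
  around the tree of predecessors of its halting configuration. This needs the tree to have no
  infinite path, which fails for counter automata: a loop that decrements the counter can be traced
  back forever, and a single zero test cannot detect that the counter has become too large.

  While the counter is nonzero, the automaton moves on the finite functional graph of sites, that is,
  pairs (state, head position), so an infinite backward path runs through a cycle of this graph. On
  every cycle one site is marked: the least state at the leftmost position. Before leaving a marked
  site with nonzero counter, the modified automaton tours the predecessor tree back to, but not
  through, marked sites, and stops for good unless it meets counter value 0. A halting run always passes this
  test, because the run itself entered the cycle from a configuration with counter 0, and counters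
  change by at most 1. On the other hand an infinite backward path would eventually avoid counter
  value 0 altogether and so fail the test.

  Whether a site is marked depends on the letter under the head and on the behaviour of the automaton
  to the right of the head. The latter is the state of a right-to-left finite automaton, and by
  the technique of Hopcroft and Ullman a two-way head can carry this state along in both directions.
\<close>

section \<open>Relations\<close>

lemma single_valued_rtrancl_stuck:
  assumes "single_valued r" "(s, w) \<in> r\<^sup>*" "(s, z) \<in> r\<^sup>*" "z \<notin> Domain r"
  shows "(w, z) \<in> r\<^sup>*"
  using single_valued_confluent[OF assms(1-3)] Not_Domain_rtrancl[OF assms(4)] by auto

lemma single_valued_stuck_terminates:
  assumes "single_valued r" "(u, z) \<in> r\<^sup>*" "z \<notin> Domain r"
  shows "u \<in> Wellfounded.acc (r\<inverse>)"
  using assms(2)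
proof (induction rule: converse_rtrancl_induct)
  case base
  show ?case using assms(3) by (auto intro: accI)
next
  case (step u v)
  show ?case
  proof (rule accI)
    fix w assume "(w, u) \<in> r\<inverse>"
    hence "w = v" using assms(1) step(1) by (auto dest: single_valuedD)
    thus "w \<in> Wellfounded.acc (r\<inverse>)" using step(3) by simp
  qed
qed

lemma single_valued_cycle_absorbs:
  assumes "single_valued r" "s \<subseteq> r" and cycle: "(m, m) \<in> s\<^sup>+" and "(m, v) \<in> r\<^sup>*"
  shows "(m, v) \<in> s\<^sup>* \<and> (v, m) \<in> s\<^sup>+"
  using assms(4)
proof (induction rule: rtrancl_induct)
  case base
  show ?case using cycle by simp
next
  case (step v w)
  obtain w' where w': "(v, w') \<in> s" "(w', m) \<in> s\<^sup>*" using step(3) tranclD by metis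
  have "w' = w" using assms(1,2) w'(1) step(2) by (auto dest: single_valuedD)
  thus ?case using step(3) w' cycle by (auto intro: rtrancl_into_rtrancl rtrancl_trancl_trancl)
qed

lemma rtrancl_first:
  assumes "(u, v) \<in> r\<^sup>*" "P v"
  shows "\<exists>w. (u, w) \<in> {(a, b) \<in> r. \<not> P a}\<^sup>* \<and> P w \<and> (w, v) \<in> r\<^sup>*"
  using assms(1)
proof (induction rule: converse_rtrancl_induct)
  case base
  show ?case using assms(2) by blast
next
  case (step t u)
  show ?case
  proof (cases "P t")
    case True
    thus ?thesis using step(1,2) by (blast intro: converse_rtrancl_into_rtrancl)
  next
    case False
    hence "(t, u) \<in> {(a, b) \<in> r. \<not> P a}" using step(1) by simp
    thus ?thesis using step(3) by (blast intro: converse_rtrancl_into_rtrancl)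
  qed
qed

lemma trancl_within:
  assumes "(u, v) \<in> r\<^sup>+" "u \<in> X" and closed: "\<And>u v. u \<in> X \<Longrightarrow> (u, v) \<in> r \<Longrightarrow> (u, v) \<in> s \<and> v \<in> X"
  shows "(u, v) \<in> s\<^sup>+ \<and> v \<in> X"
  using assms(1,2) by (induction rule: trancl_induct) (auto dest: closed intro: trancl_into_trancl)

lemma not_acc_backward_chain:
  assumes "u \<notin> Wellfounded.acc r"
  obtains F where "F 0 = u" "\<And>i::nat. (F (Suc i), F i) \<in> r"
proof -
  have "\<exists>F. \<forall>i. (F i \<notin> Wellfounded.acc r \<and> (i = 0 \<longrightarrow> F i = u)) \<and> (F (Suc i), F i) \<in> r"
    by (rule dependent_nat_choice) (use assms in \<open>auto elim: not_acc_down\<close>)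
  thus thesis using that by blast
qed

lemma single_valued_backward_chain_inj:
  assumes "single_valued r" "F 0 \<notin> Domain r" and chain: "\<And>i::nat. (F (Suc i), F i) \<in> r"
  shows "inj F"
proof -
  have "F i \<noteq> F (i + Suc d)" for i d
  proof (induction i)
    case 0
    show ?case using assms(2) chain[of d] by auto
  next
    case (Suc i)
    thus ?case using assms(1) chain[of i] chain[of "i + Suc d"] by (auto dest: single_valuedD)
  qed
  thus ?thesis by (intro linorder_injI) (metis less_imp_Suc_add add_Suc_right)
qed

lemma finite_rtrancl_preimage:
  assumes "wf r" and "\<And>v. finite {u. (u, v) \<in> r}"
  shows "finite {u. (u, v) \<in> r\<^sup>*}"
  using assms(1)
proof (induction v rule: wf_induct_rule)
  case (less v)
  have "{u. (u, v) \<in> r\<^sup>*} = insert v (\<Union>w\<in>{w. (w, v) \<in> r}. {u. (u, w) \<in> r\<^sup>*})"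
    by (auto elim: rtranclE intro: rtrancl_into_rtrancl)
  thus ?case using assms(2) less by simp
qed

lemma acc_simulation:
  assumes "w \<in> Wellfounded.acc s"
    and detours: "wf {(u, v) \<in> r. u \<notin> X \<and> v \<notin> X}"
    and enter: "\<And>u v w. (u, v) \<in> r \<Longrightarrow> u \<in> X \<Longrightarrow> (v, e w) \<in> {(u, v) \<in> r. u \<notin> X}\<^sup>* \<Longrightarrow> \<exists>w'. u = e w' \<and> (w', w) \<in> s"
  shows "e w \<in> Wellfounded.acc r"
  using assms(1)
proof (induction rule: acc_induct_rule)
  case (1 w)
  let ?r = "{(u, v) \<in> r. u \<notin> X}"
  have detour: "(v, e w) \<in> ?r\<^sup>+ \<Longrightarrow> v \<in> Wellfounded.acc r" for v
    using detours
  proof (induction v rule: wf_induct_rule)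
    case (less v)
    show ?case
    proof (rule accI)
      fix u assume u: "(u, v) \<in> r"
      have v: "v \<notin> X" using less(2) by (auto dest: tranclD)
      show "u \<in> Wellfounded.acc r"
      proof (cases "u \<in> X")
        case True
        thus ?thesis using enter[OF u] less(2) 1(2) by (blast dest: trancl_into_rtrancl)
      next
        case False
        hence "(u, e w) \<in> ?r\<^sup>+" using u less(2) by (intro trancl_into_trancl2[of u v]) auto
        thus ?thesis using less(1) u v False by simp
      qed
    qed
  qed
  show ?case
  proof (rule accI)
    fix u assume u: "(u, e w) \<in> r"
    show "u \<in> Wellfounded.acc r"
    proof (cases "u \<in> X")
      case True
      thus ?thesis using enter[OF u] 1(2) by blast
    next
      case False
      thus ?thesis using detour[of u] u by (simp add: r_into_trancl')
    qed
  qed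
qed

text \<open>\<open>node f v i\<close> is the state of a depth-first tour of the \<open>r\<close>-predecessors of \<open>v\<close> in which the first \<open>i\<close>
  of \<open>m\<close> slots of \<open>v\<close> are done; the flag \<open>f\<close> is raised at the latest when a slot that \<open>hit\<close> marks is passed.\<close>

lemma subtree_tour:
  fixes node :: "bool \<Rightarrow> 'v \<Rightarrow> nat \<Rightarrow> 's"
  assumes "v \<in> Wellfounded.acc r" "v \<in> V" "i \<le> m"
    and slot: "\<And>f v i. v \<in> V \<Longrightarrow> i < m \<Longrightarrow>
      (\<exists>f'. (node f v i, node f' v (Suc i)) \<in> s\<^sup>* \<and> (f \<or> hit v i \<longrightarrow> f')) \<or>
      (\<exists>u\<in>V. (u, v) \<in> r \<and> (node f v i, node f u 0) \<in> s\<^sup>* \<and> (\<forall>f'. (node f' u m, node f' v (Suc i)) \<in> s\<^sup>*) \<and>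
        (hit v i \<longrightarrow> (\<exists>j<m. hit u j)))"
  shows "\<exists>f'. (node f v i, node f' v m) \<in> s\<^sup>* \<and> (f \<or> (\<exists>j. i \<le> j \<and> j < m \<and> hit v j) \<longrightarrow> f')"
  using assms(1-3)
proof (induction v arbitrary: f i rule: acc_induct_rule)
  case (1 v)
  have pass_slot: "\<exists>f'. (node f v i, node f' v (Suc i)) \<in> s\<^sup>* \<and> (f \<or> hit v i \<longrightarrow> f')" if "i < m" for f i
    using slot[OF 1(3) that, of f]
  proof (elim disjE bexE conjE)
    fix u assume u: "u \<in> V" "(u, v) \<in> r" "(node f v i, node f u 0) \<in> s\<^sup>*"
      "\<forall>f'. (node f' u m, node f' v (Suc i)) \<in> s\<^sup>*" "hit v i \<longrightarrow> (\<exists>j<m. hit u j)"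
    obtain f' where "(node f u 0, node f' u m) \<in> s\<^sup>*" "f \<or> (\<exists>j<m. hit u j) \<longrightarrow> f'"
      using 1(2)[OF u(2,1), of 0 f] by auto
    thus ?thesis using u(3-5) by (meson rtrancl_trans)
  qed simp
  show ?case using 1(4)
  proof (induction i arbitrary: f rule: inc_induct)
    case base
    show ?case by (intro exI[of _ f]) auto
  next
    case (step i)
    obtain f1 where f1: "(node f v i, node f1 v (Suc i)) \<in> s\<^sup>*" "f \<or> hit v i \<longrightarrow> f1"
      using pass_slot[OF step(2)] by blast
    obtain f2 where f2: "(node f1 v (Suc i), node f2 v m) \<in> s\<^sup>*" "f1 \<or> (\<exists>j. Suc i \<le> j \<and> j < m \<and> hit v j) \<longrightarrow> f2"
      using step(3) by blast
    have "f \<or> (\<exists>j. i \<le> j \<and> j < m \<and> hit v j) \<longrightarrow> f2" using f1(2) f2(2) by (metis Suc_leI le_neq_implies_less)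
    thus ?case using rtrancl_trans[OF f1(1) f2(1)] by blast
  qed
qed

corollary subtree_tour_unflagged:
  fixes node :: "'v \<Rightarrow> nat \<Rightarrow> 's"
  assumes "v \<in> Wellfounded.acc r" "v \<in> V" "i \<le> m"
    and slot: "\<And>v i. v \<in> V \<Longrightarrow> i < m \<Longrightarrow> (node v i, node v (Suc i)) \<in> s\<^sup>* \<or>
      (\<exists>u\<in>V. (u, v) \<in> r \<and> (node v i, node u 0) \<in> s\<^sup>* \<and> (node u m, node v (Suc i)) \<in> s\<^sup>*)"
  shows "(node v i, node v m) \<in> s\<^sup>*"
  using subtree_tour[of v r V i m "\<lambda>_. node" s "\<lambda>_ _. False"] assms by blast

section \<open>Local machines\<close>

text \<open>A partial transition function reads the state, the letter, an annotation of the head position and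
  whether the counter is 0. Head positions are integers, since local machines never move across the ends
  of the tape.\<close>

type_synonym 'q config = "'q \<times> int \<times> int"
type_synonym ('q, 'a, 'b) local_trans = "'q \<Rightarrow> 'a tsym \<Rightarrow> 'b \<Rightarrow> bool \<Rightarrow> ('q \<times> int \<times> int) option"

abbreviation counter :: "'q \<times> int \<times> 'p \<Rightarrow> int" where "counter u \<equiv> fst (snd u)"
abbreviation position :: "'q \<times> int \<times> 'p \<Rightarrow> 'p" where "position u \<equiv> snd (snd u)"

abbreviation last_position :: "'a list \<Rightarrow> int" where "last_position x \<equiv> int (length x) + 1"
abbreviation on_tape :: "'a list \<Rightarrow> int \<Rightarrow> bool" where "on_tape x b \<equiv> 0 \<le> b \<and> b \<le> last_position x"

definition letter_at :: "'a list \<Rightarrow> int \<Rightarrow> 'a tsym" where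
  "letter_at x b = tape x (nat b)"

definition leaves_tape :: "'a tsym \<Rightarrow> int \<Rightarrow> bool" where
  "leaves_tape \<sigma> d \<longleftrightarrow> \<sigma> = Cent \<and> d = -1 \<or> \<sigma> = Dollar \<and> d = 1"

definition legal_moves :: "'q set \<Rightarrow> 'a tsym \<Rightarrow> ('q \<times> int \<times> int) set" where
  "legal_moves Q \<sigma> = {(q, c, d). q \<in> Q \<and> c \<in> incs \<and> d \<in> incs \<and> \<not> leaves_tape \<sigma> d}"

definition configs :: "'q set \<Rightarrow> 'a list \<Rightarrow> 'q config set" where
  "configs Q x = Q \<times> UNIV \<times> {0..last_position x}"

definition local_step :: "('q, 'a, 'b) local_trans \<Rightarrow> 'a list \<Rightarrow> (int \<Rightarrow> 'b) \<Rightarrow> 'q config \<Rightarrow> 'q config option" where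
  "local_step \<delta> x \<gamma> = (\<lambda>(q, a, b).
     map_option (\<lambda>(q', c, d). (q', a + c, b + d)) (\<delta> q (letter_at x b) (\<gamma> b) (a = 0)))"

definition step_rel :: "('q, 'a, 'b) local_trans \<Rightarrow> 'q set \<Rightarrow> 'a list \<Rightarrow> (int \<Rightarrow> 'b) \<Rightarrow> 'q config rel" where
  "step_rel \<delta> Q x \<gamma> = {(u, v). u \<in> configs Q x \<and> local_step \<delta> x \<gamma> u = Some v}"

lemma letter_at_eq_Cent_iff: "0 \<le> b \<Longrightarrow> letter_at x b = Cent \<longleftrightarrow> b = 0"
  by (auto simp: letter_at_def tape_def)

lemma letter_at_eq_Dollar_iff: "0 \<le> b \<Longrightarrow> letter_at x b = Dollar \<longleftrightarrow> b = last_position x"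
  by (auto simp: letter_at_def tape_def nat_eq_iff)

lemma leaves_tape_iff:
  "on_tape x b \<Longrightarrow> d \<in> incs \<Longrightarrow> leaves_tape (letter_at x b) d \<longleftrightarrow> \<not> on_tape x (b + d)"
  by (auto simp: leaves_tape_def letter_at_eq_Cent_iff letter_at_eq_Dollar_iff incs_def)

lemma finite_incs [simp]: "finite incs"
  by (simp add: incs_def)

lemma mem_legal_moves: "(q, c, d) \<in> legal_moves Q \<sigma> \<longleftrightarrow> q \<in> Q \<and> c \<in> incs \<and> d \<in> incs \<and> \<not> leaves_tape \<sigma> d"
  by (simp add: legal_moves_def)

lemma mem_configs: "(q, a, b) \<in> configs Q x \<longleftrightarrow> q \<in> Q \<and> on_tape x b"
  by (auto simp: configs_def)

lemma local_step_eq_Some_iff: "local_step \<delta> x \<gamma> (q, a, b) = Some v \<longleftrightarrow>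
    (\<exists>q' c d. \<delta> q (letter_at x b) (\<gamma> b) (a = 0) = Some (q', c, d) \<and> v = (q', a + c, b + d))"
  by (auto simp: local_step_def)

lemma step_rel_iff: "((q, a, b), v) \<in> step_rel \<delta> Q x \<gamma> \<longleftrightarrow> q \<in> Q \<and> on_tape x b \<and>
    (\<exists>q' c d. \<delta> q (letter_at x b) (\<gamma> b) (a = 0) = Some (q', c, d) \<and> v = (q', a + c, b + d))"
  by (auto simp: step_rel_def mem_configs local_step_eq_Some_iff)

lemma step_relI:
  "\<delta> q (letter_at x b) (\<gamma> b) (a = 0) = Some (q', c, d) \<Longrightarrow> q \<in> Q \<Longrightarrow> on_tape x b \<Longrightarrow>
   ((q, a, b), (q', a + c, b + d)) \<in> step_rel \<delta> Q x \<gamma>"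
  by (simp add: step_rel_iff)

lemma step_relE:
  assumes "(u, v) \<in> step_rel \<delta> Q x \<gamma>"
  obtains q a b p c d where "u = (q, a, b)" "v = (p, a + c, b + d)" "q \<in> Q" "on_tape x b"
    "\<delta> q (letter_at x b) (\<gamma> b) (a = 0) = Some (p, c, d)"
  using assms by (cases u) (auto simp: step_rel_iff)

lemma single_valued_step_rel: "single_valued (step_rel \<delta> Q x \<gamma>)"
  by (auto simp: single_valued_def step_rel_def)

locale local_machine =
  fixes \<delta> :: "('q, 'a, 'b) local_trans" and Q :: "'q set"
  assumes finite_states: "finite Q"
    and trans_legal: "q \<in> Q \<Longrightarrow> \<delta> q \<sigma> \<beta> z = Some k \<Longrightarrow> k \<in> legal_moves Q \<sigma>"
begin

lemma trans_legalD:
  assumes "q \<in> Q" "\<delta> q \<sigma> \<beta> z = Some (q', c, d)"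
  shows "q' \<in> Q" "c \<in> incs" "d \<in> incs" "\<not> leaves_tape \<sigma> d"
  using trans_legal[OF assms] by (auto simp: mem_legal_moves)

lemma step_rel_in_configs:
  assumes "(u, v) \<in> step_rel \<delta> Q x \<gamma>"
  shows "u \<in> configs Q x" "v \<in> configs Q x"
proof -
  obtain q a b p c d where u: "u = (q, a, b)" "v = (p, a + c, b + d)" "q \<in> Q" "on_tape x b"
    and trans: "\<delta> q (letter_at x b) (\<gamma> b) (a = 0) = Some (p, c, d)"
    using assms by (rule step_relE)
  show "u \<in> configs Q x" "v \<in> configs Q x"
    using u trans_legalD[OF u(3) trans] leaves_tape_iff[OF u(4), of d] by (auto simp: mem_configs)
qed

lemma step_rel_rtrancl_in_configs: "(u, v) \<in> (step_rel \<delta> Q x \<gamma>)\<^sup>* \<Longrightarrow> u \<in> configs Q x \<Longrightarrow> v \<in> configs Q x"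
  by (induction rule: rtrancl_induct) (auto dest: step_rel_in_configs)

text \<open>Candidates for the incoming transitions of a configuration, each given by its source state, counter
  change and head move.\<close>

definition num_moves :: nat where "num_moves = card (Q \<times> incs \<times> incs)"
definition move_of :: "nat \<Rightarrow> 'q \<times> int \<times> int" where "move_of = from_nat_into (Q \<times> incs \<times> incs)"
definition move_index :: "'q \<times> int \<times> int \<Rightarrow> nat" where "move_index = to_nat_on (Q \<times> incs \<times> incs)"

lemma finite_moves: "finite (Q \<times> incs \<times> incs)"
  using finite_states by simp

lemma move_of_in: "Q \<noteq> {} \<Longrightarrow> move_of i \<in> Q \<times> incs \<times> incs"
  unfolding move_of_def by (rule from_nat_into) (auto simp: incs_def)

lemma move_index_less: "k \<in> Q \<times> incs \<times> incs \<Longrightarrow> move_index k < num_moves"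
  using to_nat_on_finite[OF finite_moves] by (auto simp: bij_betw_def move_index_def num_moves_def)

lemma move_of_index: "k \<in> Q \<times> incs \<times> incs \<Longrightarrow> move_of (move_index k) = k"
  using countable_finite[OF finite_moves] by (simp add: move_of_def move_index_def)

lemma move_index_of: "i < num_moves \<Longrightarrow> move_index (move_of i) = i"
  using to_nat_on_finite[OF finite_moves] by (auto simp: bij_betw_def move_of_def move_index_def num_moves_def)

lemma trans_move_index:
  assumes "q \<in> Q" "\<delta> q \<sigma> \<beta> z = Some (p, c, d)"
  shows "move_index (q, c, d) < num_moves" "move_of (move_index (q, c, d)) = (q, c, d)"
  using assms(1) trans_legalD[OF assms] by (simp_all add: move_index_less move_of_index)

definition source :: "'q config \<Rightarrow> nat \<Rightarrow> 'q config" where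
  "source v i = (case move_of i of (p, c, d) \<Rightarrow> (p, counter v - c, position v - d))"

lemma step_rel_source:
  assumes "(u, v) \<in> step_rel \<delta> Q x \<gamma>"
  shows "\<exists>i<num_moves. u = source v i"
proof -
  obtain q a b p c d where "u = (q, a, b)" "v = (p, a + c, b + d)" "q \<in> Q"
    "\<delta> q (letter_at x b) (\<gamma> b) (a = 0) = Some (p, c, d)" using assms by (rule step_relE)
  thus ?thesis using trans_move_index[of q] by (intro exI[of _ "move_index (q, c, d)"]) (simp add: source_def)
qed

end

locale decider = local_machine \<delta> Q
  for \<delta> :: "('q, 'a, 'b) local_trans" and Q :: "'q set" +
  fixes q0 :: 'q and A R :: "'q set" and \<gamma> :: "'a list \<Rightarrow> int \<Rightarrow> 'b" and L :: "'a list set"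
  assumes init_state: "q0 \<in> Q" and init_not_final: "q0 \<notin> A \<union> R"
    and accepting: "A \<subseteq> Q" and rejecting: "R \<subseteq> Q" and disjoint: "A \<inter> R = {}"
    and final_trans: "q \<in> A \<union> R \<Longrightarrow> \<delta> q \<sigma> \<beta> z = None"
    and decides: "\<exists>u. ((q0, 0, 0), u) \<in> (step_rel \<delta> Q x (\<gamma> x))\<^sup>* \<and> fst u \<in> (if x \<in> L then A else R)"
begin

abbreviation steps :: "'a list \<Rightarrow> 'q config rel" where
  "steps x \<equiv> step_rel \<delta> Q x (\<gamma> x)"

lemma final_stuck: "fst u \<in> A \<union> R \<Longrightarrow> u \<notin> Domain (steps x)"
  using final_trans by (auto elim!: step_relE)

lemma source_not_final: "(u, v) \<in> steps x \<Longrightarrow> fst u \<notin> A \<union> R"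
  using final_stuck by blast

lemma move_of_components: "move_of i = (p, c, d) \<Longrightarrow> p \<in> Q \<and> c \<in> incs \<and> d \<in> incs"
  using move_of_in[of i] init_state by auto

lemma run_in_configs: "((q0, 0, 0), u) \<in> (steps x)\<^sup>* \<Longrightarrow> u \<in> configs Q x"
  by (erule step_rel_rtrancl_in_configs) (simp add: mem_configs init_state)

end

locale tame_decider = decider +
  assumes tame: "\<exists>u. ((q0, 0, 0), u) \<in> (step_rel \<delta> Q x (\<gamma> x))\<^sup>* \<and> fst u \<in> A \<union> R \<and>
    u \<in> Wellfounded.acc (step_rel \<delta> Q x (\<gamma> x))"
begin

lemma run_acc:
  assumes "((q0, 0, 0), u) \<in> (steps x)\<^sup>*"
  shows "u \<in> Wellfounded.acc (steps x)"
proof -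
  obtain z where z: "((q0, 0, 0), z) \<in> (steps x)\<^sup>*" "fst z \<in> A \<union> R" "z \<in> Wellfounded.acc (steps x)"
    using tame by blast
  have "(u, z) \<in> (steps x)\<^sup>*"
    using single_valued_rtrancl_stuck[OF single_valued_step_rel assms z(1) final_stuck[OF z(2)]] .
  with z(3) show ?thesis by (rule acc_downwards)
qed

end

section \<open>Permutation machines as simple 2R1CAs\<close>

definition perm_qca :: "'q set \<Rightarrow> 'q \<Rightarrow> 'q set \<Rightarrow> 'q set \<Rightarrow> ('a tsym \<Rightarrow> nat \<Rightarrow> 'q \<Rightarrow> 'q) \<Rightarrow>
    ('q \<Rightarrow> int) \<Rightarrow> ('q \<Rightarrow> dir) \<Rightarrow> ('q, 'a) qca" where
  "perm_qca S i A R \<pi> C D = \<lparr>qstates = S, qinit = i, qacc = A, qrej = R,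
     qtrans = (\<lambda>q \<sigma> s q' c d. of_bool (q' = \<pi> \<sigma> s q \<and> c = C q' \<and> d = D q'))\<rparr>"

lemma perm_qca_simps [simp]:
  "qstates (perm_qca S i A R \<pi> C D) = S" "qinit (perm_qca S i A R \<pi> C D) = i"
  "qacc (perm_qca S i A R \<pi> C D) = A" "qrej (perm_qca S i A R \<pi> C D) = R"
  "qtrans (perm_qca S i A R \<pi> C D) q \<sigma> s q' c d = of_bool (q' = \<pi> \<sigma> s q \<and> c = C q' \<and> d = D q')"
  by (simp_all add: perm_qca_def)

lemma in_dirs [simp]: "d \<in> dirs"
  by (cases d) (simp_all add: dirs_def)

lemma finite_dirs [simp]: "finite dirs"
  by (simp add: dirs_def)

lemma W_perm_qca:
  assumes "finite S" "\<And>q. C q \<in> incs" and "\<pi> \<sigma>1 s1 q1 \<in> S"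
  shows "W (perm_qca S i A R \<pi> C D) \<alpha> \<beta> q1 \<sigma>1 s1 q2 \<sigma>2 s2 = of_bool (\<alpha> = 0 \<and> \<beta> = 0 \<and> \<pi> \<sigma>1 s1 q1 = \<pi> \<sigma>2 s2 q2)"
proof -
  let ?p = "\<pi> \<sigma>1 s1 q1" and ?p' = "\<pi> \<sigma>2 s2 q2"
  have target_sum: "(\<Sum>(c1, d1)\<in>incs \<times> dirs. \<Sum>(c2, d2)\<in>incs \<times> dirs.
        if c2 - c1 = \<alpha> \<and> mu d2 - mu d1 = \<beta>
        then cnj (of_bool (q' = ?p \<and> c1 = C q' \<and> d1 = D q')) * of_bool (q' = ?p' \<and> c2 = C q' \<and> d2 = D q')
        else 0) = (if q' = ?p then of_bool (\<alpha> = 0 \<and> \<beta> = 0 \<and> ?p = ?p') else (0::complex))" (is "?sum = _") for q'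
  proof -
    let ?move = "(C q', D q')"
    let ?k = "of_bool (q' = ?p \<and> q' = ?p' \<and> \<alpha> = 0 \<and> \<beta> = 0) :: complex"
    have summand: "(if c2 - c1 = \<alpha> \<and> mu d2 - mu d1 = \<beta>
        then cnj (of_bool (P \<and> c1 = c \<and> d1 = d)) * of_bool (P' \<and> c2 = c \<and> d2 = d) else 0)
      = (if (c2, d2) = (c, d)
         then if (c1, d1) = (c, d) then of_bool (P \<and> P' \<and> \<alpha> = 0 \<and> \<beta> = 0) else 0
         else (0::complex))" for P P' c c1 c2 d d1 d2
      by (cases "c1 = c"; cases "c2 = c"; cases "d1 = d"; cases "d2 = d"; cases "\<alpha> = 0"; simp)
    have "?sum = (\<Sum>m1\<in>incs \<times> dirs. \<Sum>m2\<in>incs \<times> dirs. if m2 = ?move then if m1 = ?move then ?k else 0 else 0)"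
      by (simp only: case_prod_unfold summand prod.collapse)
    also have "\<dots> = ?k"
      using assms(2) by simp
    finally show ?thesis by auto
  qed
  show ?thesis
    using assms by (simp only: W_def perm_qca_simps target_sum) simp
qed

definition ket :: "'q \<times> int \<times> nat \<Rightarrow> 'q qvec" where
  "ket u = (\<lambda>v. of_bool (v = u))"

lemma normsq_ket: "normsq (ket u) = 1"
proof -
  have "infsum (\<lambda>v. (cmod (ket u v))\<^sup>2) UNIV = infsum (\<lambda>v. (cmod (ket u v))\<^sup>2) {u}"
    by (rule infsum_cong_neutral) (auto simp: ket_def)
  thus ?thesis by (simp add: normsq_def ket_def)
qed

lemma normsq_zero: "normsq (\<lambda>_. 0) = 0"
  by (simp add: normsq_def)

lemma proj_zero: "proj F (\<lambda>_. 0) = (\<lambda>_. 0)"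
  by (auto simp: proj_def)

lemma proj_ket: "proj F (ket u) = (if fst u \<in> F then ket u else (\<lambda>_. 0))"
  by (cases u) (auto simp: proj_def ket_def fun_eq_iff)

lemma Ux_zero: "Ux M x (\<lambda>_. 0) = (\<lambda>_. 0)"
  by (auto simp: Ux_def Let_def)

lemma move_le: "move x b d \<le> length x + 1"
proof -
  have "(int b + d) mod int (length x + 2) < int (length x + 2)" by (intro pos_mod_bound) simp
  thus ?thesis unfolding move_def by linarith
qed

lemma move_move: "b \<le> length x + 1 \<Longrightarrow> move x (move x b d) (- d) = b"
  unfolding move_def by (simp add: mod_simps)

lemma move_minus_eq_iff:
  assumes "b \<le> length x + 1" "b' \<le> length x + 1"
  shows "move x b' (- d) = b \<longleftrightarrow> b' = move x b d"
  using move_move[OF assms(1), of d] move_move[OF assms(2), of "- d"] by auto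

locale perm_machine =
  fixes S :: "'q set" and i0 :: 'q and A R :: "'q set" and \<pi> :: "'a tsym \<Rightarrow> nat \<Rightarrow> 'q \<Rightarrow> 'q"
    and C :: "'q \<Rightarrow> int" and D :: "'q \<Rightarrow> dir"
  assumes finite_states: "finite S" and init_state: "i0 \<in> S"
    and accepting: "A \<subseteq> S" and rejecting: "R \<subseteq> S" and disjoint: "A \<inter> R = {}"
    and counter_change: "C q \<in> incs"
    and closed: "s \<in> {0, 1} \<Longrightarrow> q \<in> S \<Longrightarrow> \<pi> \<sigma> s q \<in> S"
    and inj: "s \<in> {0, 1} \<Longrightarrow> inj_on (\<pi> \<sigma> s) S"
begin

abbreviation qca :: "('q, 'a) qca" where "qca \<equiv> perm_qca S i0 A R \<pi> C D"

lemma well_formed_qca: "well_formed qca"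
proof -
  have W: "W qca \<alpha> \<beta> q1 \<sigma>1 s1 q2 \<sigma>2 s2 = of_bool (\<alpha> = 0 \<and> \<beta> = 0 \<and> \<pi> \<sigma>1 s1 q1 = \<pi> \<sigma>2 s2 q2)"
    if "q1 \<in> S" "s1 \<in> {0, 1}" for \<alpha> \<beta> q1 \<sigma>1 s1 q2 \<sigma>2 s2
    using finite_states counter_change closed[OF that(2,1)] by (rule W_perm_qca)
  have \<pi>_eq: "\<pi> \<sigma> s q1 = \<pi> \<sigma> s q2 \<longleftrightarrow> q1 = q2" if "q1 \<in> S" "q2 \<in> S" "s \<in> {0, 1}" for \<sigma> s q1 q2
    using inj_on_eq_iff[OF inj[OF that(3)] that(1,2)] .
  show ?thesis unfolding well_formed_def perm_qca_simps
    by (intro ballI conjI allI impI) (simp_all only: W \<pi>_eq, auto)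
qed

lemma is_2R1CA_qca: "is_2R1CA qca"
  using well_formed_qca finite_states init_state accepting rejecting disjoint
  by (auto simp: is_2R1CA_def valid_qca_def)

lemma is_simple_qca: "is_simple qca"
  unfolding is_simple_def
  by (rule exI[of _ "\<lambda>\<sigma> s q' q. of_bool (q' = \<pi> \<sigma> s q)"], rule exI[of _ "\<lambda>q \<sigma>. C q"], rule exI[of _ D])
    (auto simp: counter_change)

definition succ_config :: "'a list \<Rightarrow> 'q \<times> int \<times> nat \<Rightarrow> 'q \<times> int \<times> nat" where
  "succ_config x = (\<lambda>(q, a, b). let q' = \<pi> (tape x b) (sgnc a) q in (q', a + C q', move x b (mu (D q'))))"

lemma succ_config_closed: "fst u \<in> S \<Longrightarrow> fst (succ_config x u) \<in> S \<and> position (succ_config x u) \<le> length x + 1"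
  using closed[of "sgnc (counter u)"] move_le
  by (auto simp: succ_config_def Let_def sgnc_def split: prod.splits)

lemma Ux_ket:
  assumes "fst u \<in> S" "position u \<le> length x + 1"
  shows "Ux qca x (ket u) = ket (succ_config x u)"
proof
  fix v :: "'q \<times> int \<times> nat"
  obtain q a b where u: "u = (q, a, b)" by (cases u)
  obtain q' a' b' where v: "v = (q', a', b')" by (cases v)
  show "Ux qca x (ket u) v = ket (succ_config x u) v"
  proof (cases "q' \<in> S \<and> b' \<le> length x + 1")
    case True
    have summand: "ket u (r, a' - c, move x b' (- mu d)) *
         of_bool (q' = \<pi> (tape x (move x b' (- mu d))) (sgnc (a' - c)) r \<and> c = C q' \<and> d = D q')
       = (if d = D q' then if c = C q' then if r = q then of_bool (v = succ_config x u) else 0 else 0 else 0)"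
      for r c d
    proof (cases "r = q \<and> c = C q' \<and> d = D q'")
      case same: True
      have "move x b' (- mu d) = b \<longleftrightarrow> b' = move x b (mu d)"
        using move_minus_eq_iff[of b x b'] assms(2) True u by simp
      moreover have "a' - c = a \<longleftrightarrow> a' = a + c" by auto
      ultimately show ?thesis using same move_move[of b x "mu d"] assms(2)
        by (auto simp: ket_def succ_config_def Let_def u v)
    qed (auto simp: ket_def u)
    have "Ux qca x (ket u) v = (\<Sum>r\<in>S. \<Sum>c\<in>incs. \<Sum>d\<in>dirs. if d = D q' then if c = C q' then
        if r = q then of_bool (v = succ_config x u) else 0 else 0 else 0)"
      using True by (simp add: Ux_def Let_def v summand)
    also have "\<dots> = of_bool (v = succ_config x u)"
      using assms(1) u counter_change finite_states by simp
    finally show ?thesis by (simp add: ket_def)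
  next
    case False
    hence "v \<noteq> succ_config x u"
      using succ_config_closed[OF assms(1), of x] by (cases "succ_config x u") (auto simp: v)
    thus ?thesis using False by (auto simp: Ux_def ket_def v)
  qed
qed

abbreviation run :: "'a list \<Rightarrow> nat \<Rightarrow> 'q \<times> int \<times> nat" where
  "run x t \<equiv> (succ_config x ^^ t) (i0, 0, 0)"

lemma run_closed: "fst (run x t) \<in> S \<and> position (run x t) \<le> length x + 1"
  by (induction t) (use init_state succ_config_closed in auto)

lemma qvec_at_run:
  assumes "\<And>s. 0 < s \<Longrightarrow> s \<le> t \<Longrightarrow> fst (run x s) \<notin> A \<union> R"
  shows "qvec_at qca x t = ket (run x t)"
  using assms
proof (induction t)
  case 0
  show ?case by (auto simp: ket_def)
next
  case (Suc t)
  have "qvec_at qca x t = ket (run x t)" using Suc by simp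
  thus ?case using Suc.prems[of "Suc t"] Ux_ket[of "run x t" x] run_closed[of t x] by (simp add: proj_ket)
qed

lemma halting_run_sums:
  assumes running: "\<And>t. 0 < t \<Longrightarrow> t \<le> k \<Longrightarrow> fst (run x t) \<notin> A \<union> R"
    and halt: "fst (run x (Suc k)) \<in> F" and F: "F \<subseteq> A \<union> R"
  shows "(\<lambda>t. normsq (proj F (Ux qca x (qvec_at qca x t)))) sums 1"
proof -
  have Ux_run: "Ux qca x (qvec_at qca x t) = ket (run x (Suc t))" if "t \<le> k" for t
    using qvec_at_run[of t x] running that Ux_ket[of "run x t" x] run_closed[of t x] by simp
  have vanish: "qvec_at qca x t = (\<lambda>_. 0)" if "k < t" for t
    using Suc_leI[OF that]
  proof (induction rule: dec_induct)
    case base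
    show ?case using Ux_run[of k] halt F by (auto simp: proj_ket)
  next
    case (step t)
    thus ?case by (simp add: Ux_zero proj_zero)
  qed
  have "normsq (proj F (Ux qca x (qvec_at qca x t))) = of_bool (t = k)" for t
  proof -
    consider "t < k" | "t = k" | "k < t" by linarith
    thus ?thesis
    proof cases
      case 1
      hence "fst (run x (Suc t)) \<notin> F" using running[of "Suc t"] F by auto
      thus ?thesis using 1 Ux_run[of t] by (simp add: proj_ket normsq_zero del: funpow.simps)
    next
      case 2
      thus ?thesis using Ux_run[of k] halt by (simp add: proj_ket normsq_ket del: funpow.simps)
    next
      case 3
      thus ?thesis using vanish by (simp add: Ux_zero proj_zero normsq_zero)
    qed
  qed
  thus ?thesis using sums_single[of k "\<lambda>_. 1::real"] by (simp add: of_bool_def)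
qed

end

section \<open>The reversible tour of predecessor trees\<close>

text \<open>In state \<open>Node q i\<close> the head is at a configuration with state \<open>q\<close> whose first \<open>i\<close> incoming moves
  are done; in state \<open>Try q i\<close> it is where the \<open>i\<close>-th incoming move would come from.\<close>

datatype 'q tour_state = Node 'q nat | Try 'q nat

definition dir_of :: "int \<Rightarrow> dir" where
  "dir_of d = (if d = -1 then Lft else if d = 1 then Rgt else Stay)"

lemma mu_dir_of: "d \<in> incs \<Longrightarrow> mu (dir_of d) = d"
  by (auto simp: dir_of_def incs_def)

lemma move_nat: "on_tape x b \<Longrightarrow> on_tape x (b + d) \<Longrightarrow> move x (nat b) d = nat (b + d)"
  by (simp add: move_def)

lemma move_minus_on_tape:
  assumes b: "on_tape x b" and "d \<in> incs" and stays: "\<not> leaves_tape (tape x (move x (nat b) (- d))) d"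
  shows "on_tape x (b - d)" "move x (nat b) (- d) = nat (b - d)"
proof -
  have "move x 0 (- 1) = length x + 1" by (simp add: move_def zmod_minus1)
  hence "\<not> (b = 0 \<and> d = 1)" using stays by (auto simp: leaves_tape_def tape_def)
  moreover have "\<not> (b = last_position x \<and> d = -1)"
    using stays by (auto simp: move_def leaves_tape_def tape_def)
  ultimately show "on_tape x (b - d)" using assms(1,2) by (auto simp: incs_def)
  with b show "move x (nat b) (- d) = nat (b - d)" using move_nat[of b x "- d"] by simp
qed

locale reversible_tour = tame_decider \<delta> Q q0 A R "\<lambda>_ _. ()" L
  for \<delta> :: "('q, 'a, unit) local_trans" and Q :: "'q set" and q0 :: 'q
    and A R :: "'q set" and L :: "'a list set"
begin

fun tour_next :: "'a tsym \<Rightarrow> bool \<Rightarrow> 'q tour_state \<Rightarrow> 'q tour_state" where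
  "tour_next \<sigma> z (Node q i) = (if i < num_moves then Try q i else
     (case \<delta> q \<sigma> () z of None \<Rightarrow> Node q 0 | Some (p, c, d) \<Rightarrow> Node p (Suc (move_index (q, c, d)))))"
| "tour_next \<sigma> z (Try q i) = (case move_of i of (p, c, d) \<Rightarrow>
     if \<delta> p \<sigma> () z = Some (q, c, d) then Node p 0 else Node q (Suc i))"

fun tour_prev :: "'a tsym \<Rightarrow> bool \<Rightarrow> 'q tour_state \<Rightarrow> 'q tour_state" where
  "tour_prev \<sigma> z (Node q 0) = (case \<delta> q \<sigma> () z of
     None \<Rightarrow> Node q num_moves | Some (p, c, d) \<Rightarrow> Try p (move_index (q, c, d)))"
| "tour_prev \<sigma> z (Node q (Suc i)) = (case move_of i of (p, c, d) \<Rightarrow>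
     if \<delta> p \<sigma> () z = Some (q, c, d) then Node p num_moves else Try q i)"
| "tour_prev \<sigma> z (Try q i) = Node q i"

fun tour_shift :: "'q tour_state \<Rightarrow> int \<times> int" where
  "tour_shift (Node q 0) = (0, 0)"
| "tour_shift (Node q (Suc i)) = snd (move_of i)"
| "tour_shift (Try q i) = (case move_of i of (p, c, d) \<Rightarrow> (- c, - d))"

definition tour_states :: "'q tour_state set" where
  "tour_states = (\<lambda>(q, i). Node q i) ` (Q \<times> {..num_moves}) \<union> (\<lambda>(q, i). Try q i) ` (Q \<times> {..<num_moves})"

lemma mem_tour_states [simp]:
  "Node q i \<in> tour_states \<longleftrightarrow> q \<in> Q \<and> i \<le> num_moves" "Try q i \<in> tour_states \<longleftrightarrow> q \<in> Q \<and> i < num_moves"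
  by (auto simp: tour_states_def)

lemma finite_tour_states: "finite tour_states"
  using finite_states by (simp add: tour_states_def)

lemma tour_shift_in: "tour_shift r \<in> incs \<times> incs"
proof (cases r rule: tour_shift.cases)
  case (2 q i)
  obtain p c d where "move_of i = (p, c, d)" by (cases "move_of i")
  thus ?thesis using 2 move_of_components[of i p c d] by simp
next
  case (3 q i)
  obtain p c d where "move_of i = (p, c, d)" by (cases "move_of i")
  thus ?thesis using 3 move_of_components[of i p c d] by (auto simp: incs_def)
qed (simp add: incs_def)

lemma tour_next_closed:
  assumes "r \<in> tour_states"
  shows "tour_next \<sigma> z r \<in> tour_states"
proof (cases r)
  case (Node q i)
  show ?thesis
  proof (cases "\<delta> q \<sigma> () z")
    case (Some k)
    obtain p c d where k: "k = (p, c, d)" by (cases k)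
    show ?thesis
      using assms Node Some k trans_legalD(1)[of q \<sigma> "()" z p c d] trans_move_index(1)[of q \<sigma> "()" z p c d]
      by (simp add: Suc_le_eq)
  qed (use assms Node in simp)
next
  case (Try q i)
  obtain p c d where "move_of i = (p, c, d)" by (cases "move_of i")
  thus ?thesis using assms Try move_of_components[of i p c d] by simp
qed

lemma tour_prev_next:
  assumes "r \<in> tour_states"
  shows "tour_prev \<sigma> z (tour_next \<sigma> z r) = r"
proof (cases r)
  case (Node q i)
  show ?thesis
  proof (cases "\<delta> q \<sigma> () z")
    case (Some k)
    obtain p c d where k: "k = (p, c, d)" by (cases k)
    show ?thesis using assms Node Some k trans_move_index[of q \<sigma> "()" z p c d] by simp
  qed (use assms Node in simp)
next
  case (Try q i)
  obtain p c d where "move_of i = (p, c, d)" by (cases "move_of i")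
  thus ?thesis using assms Try move_index_of[of i] by simp
qed

lemma inj_on_tour_next: "inj_on (tour_next \<sigma> z) tour_states"
  by (rule inj_on_inverseI) (rule tour_prev_next)

definition tour_step :: "'a list \<Rightarrow> 'q tour_state \<times> int \<times> nat \<Rightarrow> 'q tour_state \<times> int \<times> nat" where
  "tour_step x = (\<lambda>(r, a, b). let r' = tour_next (tape x b) (a = 0) r in
     (r', a + fst (tour_shift r'), move x b (snd (tour_shift r'))))"

definition tour_final :: "'q set \<Rightarrow> 'q tour_state set" where
  "tour_final F = {Node q i |q i. q \<in> F \<and> i \<le> num_moves}"

definition running :: "'a list \<Rightarrow> ('q tour_state \<times> int \<times> nat) rel" where
  "running x = {(u, v). v = tour_step x u \<and> fst v \<notin> tour_final A \<union> tour_final R}"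

abbreviation at_node :: "'q config \<Rightarrow> nat \<Rightarrow> 'q tour_state \<times> int \<times> nat" where
  "at_node u i \<equiv> (Node (fst u) i, counter u, nat (position u))"

lemma tour_step_up:
  assumes "(u, v) \<in> steps x"
  shows "\<exists>i<num_moves. move_of i = (fst u, counter v - counter u, position v - position u) \<and>
    tour_step x (at_node u num_moves) = at_node v (Suc i)"
proof -
  obtain q a b p c d where u: "u = (q, a, b)" "v = (p, a + c, b + d)" "q \<in> Q" "on_tape x b"
    and trans: "\<delta> q (letter_at x b) () (a = 0) = Some (p, c, d)"
    using assms by (rule step_relE)
  have index: "move_index (q, c, d) < num_moves" "move_of (move_index (q, c, d)) = (q, c, d)"
    using trans_move_index[OF u(3) trans] .
  have "on_tape x (b + d)" using step_rel_in_configs(2)[OF assms] u(2) by (simp add: mem_configs)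
  thus ?thesis using index trans u move_nat[OF u(4), of d]
    by (intro exI[of _ "move_index (q, c, d)"]) (simp add: tour_step_def letter_at_def)
qed

lemma tour_step_down:
  "i < num_moves \<Longrightarrow> move_of i = (p, c, d) \<Longrightarrow>
   tour_step x (at_node (q, a, b) i) = (Try q i, a - c, move x (nat b) (- d))"
  by (simp add: tour_step_def)

lemma tour_slot:
  assumes v: "v \<in> configs Q x" "fst v \<notin> A \<union> R" and i: "i < num_moves"
  shows "(at_node v i, at_node v (Suc i)) \<in> (running x)\<^sup>* \<or>
    (\<exists>u. (u, v) \<in> steps x \<and> (at_node v i, at_node u 0) \<in> (running x)\<^sup>* \<and>
       (at_node u num_moves, at_node v (Suc i)) \<in> (running x)\<^sup>*)"
proof -
  obtain q a b where q: "v = (q, a, b)" "on_tape x b" using v(1) by (cases v) (auto simp: mem_configs)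
  obtain p c d where move: "move_of i = (p, c, d)" by (cases "move_of i")
  note source = move_of_components[OF move]
  let ?b = "move x (nat b) (- d)"
  have down: "(at_node v i, (Try q i, a - c, ?b)) \<in> running x"
    using tour_step_down[OF i move] by (simp add: running_def tour_final_def q)
  show ?thesis
  proof (cases "\<delta> p (tape x ?b) () (a - c = 0) = Some (q, c, d)")
    case True
    have stays: "\<not> leaves_tape (tape x ?b) d" using trans_legalD(4)[OF _ True] source by simp
    note on = move_minus_on_tape[OF q(2) _ stays]
    let ?u = "(p, a - c, b - d)"
    have step: "(?u, v) \<in> steps x" using True on source by (simp add: step_rel_iff q letter_at_def)
    have "((Try q i, a - c, ?b), at_node ?u 0) \<in> running x"
      using True move on source source_not_final[OF step]
      by (simp add: running_def tour_step_def tour_final_def move_nat[where d = 0, simplified])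
    moreover have "(at_node ?u num_moves, at_node v (Suc i)) \<in> running x"
    proof -
      obtain j where j: "j < num_moves" "move_of j = (p, c, d)"
        "tour_step x (at_node ?u num_moves) = at_node v (Suc j)"
        using tour_step_up[OF step] by (auto simp: q)
      have "j = i" using move_index_of[OF i] move_index_of[OF j(1)] j(2) move by simp
      thus ?thesis using j(3) v(2) by (simp add: running_def tour_final_def)
    qed
    ultimately show ?thesis using down step by (blast intro: rtrancl_into_rtrancl)
  next
    case False
    have "nat b \<le> length x + 1" using q(2) by linarith
    hence "move x ?b d = nat b" using move_move[of "nat b" x "- d"] by simp
    hence "((Try q i, a - c, ?b), at_node v (Suc i)) \<in> running x"
      using False move v(2) by (simp add: running_def tour_step_def tour_final_def q)
    thus ?thesis using down by (blast intro: rtrancl_into_rtrancl)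
  qed
qed

lemma tour_completes:
  assumes "v \<in> Wellfounded.acc (steps x)" "v \<in> configs Q x" "fst v \<notin> A \<union> R" "i \<le> num_moves"
  shows "(at_node v i, at_node v num_moves) \<in> (running x)\<^sup>*"
proof (rule subtree_tour_unflagged[where V = "{v \<in> configs Q x. fst v \<notin> A \<union> R}"])
  fix v i assume "v \<in> {v \<in> configs Q x. fst v \<notin> A \<union> R}" "i < num_moves"
  thus "(at_node v i, at_node v (Suc i)) \<in> (running x)\<^sup>* \<or>
    (\<exists>u\<in>{v \<in> configs Q x. fst v \<notin> A \<union> R}. (u, v) \<in> steps x \<and> (at_node v i, at_node u 0) \<in> (running x)\<^sup>* \<and>
      (at_node u num_moves, at_node v (Suc i)) \<in> (running x)\<^sup>*)"
    using tour_slot[of v x i] step_rel_in_configs(1) source_not_final by blast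
qed (use assms in simp_all)

abbreviation tour_run :: "'a list \<Rightarrow> nat \<Rightarrow> 'q tour_state \<times> int \<times> nat" where
  "tour_run x t \<equiv> (tour_step x ^^ t) (Node q0 num_moves, 0, 0)"

lemma tour_follows_run:
  assumes "((q0, 0, 0), u) \<in> (steps x)\<^sup>*" "fst u \<notin> A \<union> R"
  shows "((Node q0 num_moves, 0, 0), at_node u num_moves) \<in> (running x)\<^sup>*"
  using assms
proof (induction rule: rtrancl_induct)
  case (step u v)
  obtain i where i: "i < num_moves" "tour_step x (at_node u num_moves) = at_node v (Suc i)"
    using tour_step_up[OF step(2)] by blast
  have "((Node q0 num_moves, 0, 0), at_node u num_moves) \<in> (running x)\<^sup>*"
    using step(3) source_not_final[OF step(2)] by simp
  also have "(at_node u num_moves, at_node v (Suc i)) \<in> running x"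
    using i(2) step(4) by (simp add: running_def tour_final_def)
  also have "(at_node v (Suc i), at_node v num_moves) \<in> (running x)\<^sup>*"
    using i(1) step(4) run_acc[OF rtrancl_into_rtrancl[OF step(1,2)]] step_rel_in_configs(2)[OF step(2)]
    by (intro tour_completes) simp_all
  finally show ?case .
qed simp

lemma running_tour_run:
  assumes "((Node q0 num_moves, 0, 0), v) \<in> (running x)\<^sup>*"
  shows "\<exists>k. v = tour_run x k \<and> (\<forall>t. 0 < t \<longrightarrow> t \<le> k \<longrightarrow> fst (tour_run x t) \<notin> tour_final A \<union> tour_final R)"
  using assms
proof (induction rule: rtrancl_induct)
  case base
  show ?case by (intro exI[of _ 0]) simp
next
  case (step v w)
  then obtain k where "v = tour_run x k"
    "\<forall>t. 0 < t \<longrightarrow> t \<le> k \<longrightarrow> fst (tour_run x t) \<notin> tour_final A \<union> tour_final R" by blast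
  thus ?case using step(2) by (intro exI[of _ "Suc k"]) (auto simp: running_def le_Suc_eq)
qed

lemma tour_halts:
  "\<exists>k. (\<forall>t. 0 < t \<longrightarrow> t \<le> k \<longrightarrow> fst (tour_run x t) \<notin> tour_final A \<union> tour_final R) \<and>
     fst (tour_run x (Suc k)) \<in> tour_final (if x \<in> L then A else R)"
proof -
  obtain v where v: "((q0, 0, 0), v) \<in> (steps x)\<^sup>*" "fst v \<in> (if x \<in> L then A else R)" using decides by blast
  have "(q0, 0, 0) \<noteq> v" using v(2) init_not_final by (auto split: if_splits)
  then obtain u where u: "((q0, 0, 0), u) \<in> (steps x)\<^sup>*" "(u, v) \<in> steps x" using v(1) by (meson rtranclE)
  obtain k where k: "at_node u num_moves = tour_run x k"
    "\<forall>t. 0 < t \<longrightarrow> t \<le> k \<longrightarrow> fst (tour_run x t) \<notin> tour_final A \<union> tour_final R"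
    using running_tour_run[OF tour_follows_run[OF u(1) source_not_final[OF u(2)]]] by blast
  obtain i where i: "i < num_moves" "tour_step x (at_node u num_moves) = at_node v (Suc i)"
    using tour_step_up[OF u(2)] by blast
  hence "fst (tour_run x (Suc k)) \<in> tour_final (if x \<in> L then A else R)"
    using v(2) by (simp add: k(1)[symmetric] tour_final_def)
  with k(2) show ?thesis by blast
qed

definition code :: "'q tour_state \<Rightarrow> nat" where "code = to_nat_on tour_states"
definition decode :: "nat \<Rightarrow> 'q tour_state" where "decode = from_nat_into tour_states"

lemma decode_code: "r \<in> tour_states \<Longrightarrow> decode (code r) = r"
  using countable_finite[OF finite_tour_states] by (simp add: decode_def code_def)

lemma inj_on_code: "inj_on code tour_states"
  by (rule inj_on_inverseI) (rule decode_code)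

lemma tour_final_subset: "F \<subseteq> Q \<Longrightarrow> tour_final F \<subseteq> tour_states"
  by (auto simp: tour_final_def)

sublocale coded: perm_machine "code ` tour_states" "code (Node q0 num_moves)"
  "code ` tour_final A" "code ` tour_final R" "\<lambda>\<sigma> s n. code (tour_next \<sigma> (s = 0) (decode n))"
  "\<lambda>n. fst (tour_shift (decode n))" "\<lambda>n. dir_of (snd (tour_shift (decode n)))"
proof
  have "tour_final A \<inter> tour_final R = {}" using disjoint by (auto simp: tour_final_def)
  thus "code ` tour_final A \<inter> code ` tour_final R = {}"
    using inj_on_image_Int[OF inj_on_code, of "tour_final A" "tour_final R"] accepting rejecting
    by (simp add: tour_final_subset)
  show "inj_on (\<lambda>n. code (tour_next \<sigma> (s = 0) (decode n))) (code ` tour_states)" for \<sigma> and s :: nat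
  proof (rule inj_onI, clarify)
    fix r r' assume r: "r \<in> tour_states" "r' \<in> tour_states"
      and "code (tour_next \<sigma> (s = 0) (decode (code r))) = code (tour_next \<sigma> (s = 0) (decode (code r')))"
    hence "tour_next \<sigma> (s = 0) r = tour_next \<sigma> (s = 0) r'"
      using inj_onD[OF inj_on_code] by (simp add: decode_code tour_next_closed)
    thus "code r = code r'" using inj_onD[OF inj_on_tour_next _ r] by metis
  qed
  show "fst (tour_shift (decode n)) \<in> incs" for n using tour_shift_in[of "decode n"] by auto
qed (use finite_tour_states init_state accepting rejecting in
    \<open>auto simp: decode_code tour_next_closed dest: subsetD[OF tour_final_subset]\<close>)

abbreviation code_config :: "'q tour_state \<times> int \<times> nat \<Rightarrow> nat \<times> int \<times> nat" where
  "code_config u \<equiv> (code (fst u), snd u)"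

lemma coded_succ_config:
  assumes "fst u \<in> tour_states"
  shows "coded.succ_config x (code_config u) = code_config (tour_step x u) \<and> fst (tour_step x u) \<in> tour_states"
proof -
  obtain r a b where u: "u = (r, a, b)" by (cases u)
  have "mu (dir_of (snd (tour_shift r))) = snd (tour_shift r)" for r
    using tour_shift_in[of r] by (intro mu_dir_of) auto
  thus ?thesis using assms
    by (simp add: u coded.succ_config_def tour_step_def Let_def decode_code tour_next_closed sgnc_def)
qed

lemma coded_run:
  "coded.run x t = code_config (tour_run x t) \<and>
   fst (tour_run x t) \<in> tour_states"
  by (induction t) (use init_state coded_succ_config in auto)

lemma coded_run_final_iff:
  assumes "F \<subseteq> Q"
  shows "fst (coded.run x t) \<in> code ` tour_final F \<longleftrightarrow> fst (tour_run x t) \<in> tour_final F"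
  using coded_run[of t x] inj_on_image_mem_iff[OF inj_on_code _ tour_final_subset[OF assms]] by simp

lemma coded_halting_sums:
  assumes "F = (if x \<in> L then A else R)"
  shows "(\<lambda>t. normsq (proj (code ` tour_final F) (Ux coded.qca x (qvec_at coded.qca x t)))) sums 1"
proof -
  have F: "F \<subseteq> Q" "F \<subseteq> A \<union> R" using assms accepting rejecting by auto
  obtain k where k: "\<forall>t. 0 < t \<longrightarrow> t \<le> k \<longrightarrow> fst (tour_run x t) \<notin> tour_final A \<union> tour_final R"
    "fst (tour_run x (Suc k)) \<in> tour_final F"
    using tour_halts[of x] assms by blast
  show ?thesis
  proof (rule coded.halting_run_sums)
    show "fst (coded.run x t) \<notin> code ` tour_final A \<union> code ` tour_final R" if "0 < t" "t \<le> k" for t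
      using k(1) that coded_run_final_iff[OF accepting] coded_run_final_iff[OF rejecting] by blast
    show "fst (coded.run x (Suc k)) \<in> code ` tour_final F"
      using k(2) coded_run_final_iff[OF F(1)] by blast
    show "code ` tour_final F \<subseteq> code ` tour_final A \<union> code ` tour_final R"
      using assms by auto
  qed
qed

theorem simple_reversible_qca:
  "\<exists>M' :: (nat, 'a) qca. is_2R1CA M' \<and> is_simple M' \<and>
     (\<forall>x. (x \<in> L \<longrightarrow> acc_step M' x sums 1) \<and> (x \<notin> L \<longrightarrow> rej_step M' x sums 1))"
proof (intro exI conjI allI impI)
  show "is_2R1CA coded.qca" "is_simple coded.qca" by (rule coded.is_2R1CA_qca coded.is_simple_qca)+
  show "acc_step coded.qca x sums 1" if "x \<in> L" for x
    using coded_halting_sums[of A x] that by (simp add: acc_step_def[abs_def])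
  show "rej_step coded.qca x sums 1" if "x \<notin> L" for x
    using coded_halting_sums[of R x] that by (simp add: rej_step_def[abs_def])
qed

end

section \<open>Carrying a right-to-left annotation along with the head\<close>

text \<open>A task consists of the state to continue in, the annotation of the position left of the head, and
  possibly the annotation that is expected at the head. A move to the right with annotation \<open>X\<close> must find
  the true one among the annotations \<open>y\<close> with \<open>g \<sigma> y = X\<close>. \<open>Search\<close> moves right with a relation from
  annotations of the current position to the candidates \<open>y\<close> they lead to, until one candidate is left;
  \<open>Merge\<close> then follows two annotations leading to different candidates back to the left until they merge,
  which happens exactly where the search started. A move to the left is performed only after the move back
  to the right has been checked to restore the old annotation; otherwise wrong annotations could turn into
  correct ones and enlarge the predecessor trees.\<close>

type_synonym ('q, 'b) task = "'q \<times> 'b \<times> 'b option"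

abbreviation known :: "('q, 'b) task \<Rightarrow> 'b" where "known k \<equiv> fst (snd k)"

datatype ('q, 'b) carrier_state =
    To_End | Annotate 'b | Carry 'q 'b
  | Recover "('q, 'b) task"
  | Search "('q, 'b) task" "'b rel"
  | Merge "('q, 'b) task" 'b 'b
  | Recovered "('q, 'b) task" 'b

locale annotated_decider = tame_decider \<delta> Q q0 A R \<gamma> L
  for \<delta> :: "('q, 'a, 'b) local_trans" and Q :: "'q set" and q0 :: 'q and A R :: "'q set"
    and \<gamma> :: "'a list \<Rightarrow> int \<Rightarrow> 'b" and L :: "'a list set" +
  fixes g :: "'a tsym \<Rightarrow> 'b \<Rightarrow> 'b" and \<iota> :: 'b and B :: "'b set"
  assumes finite_annotations: "finite B" and end_annotation: "\<iota> \<in> B" and update_closed: "\<beta> \<in> B \<Longrightarrow> g \<sigma> \<beta> \<in> B"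
    and annotation_last: "\<gamma> x (last_position x) = \<iota>"
    and annotation_step: "0 < b \<Longrightarrow> b \<le> last_position x \<Longrightarrow> \<gamma> x (b - 1) = g (letter_at x b) (\<gamma> x b)"
begin

definition candidates :: "'a tsym \<Rightarrow> 'b \<Rightarrow> 'b rel" where
  "candidates \<sigma> X = {(y, y) |y. y \<in> B \<and> g \<sigma> y = X}"

definition pull_back :: "'a tsym \<Rightarrow> 'b rel \<Rightarrow> 'b rel" where
  "pull_back \<sigma> \<phi> = {(s, y). s \<in> B \<and> (g \<sigma> s, y) \<in> \<phi>}"

definition possible :: "'a tsym \<Rightarrow> 'b rel \<Rightarrow> 'b set" where
  "possible \<sigma> \<phi> = (if \<sigma> = Dollar then \<phi> `` {\<iota>} else Range \<phi>)"

definition resolved :: "'a tsym \<Rightarrow> 'b rel \<Rightarrow> 'b option" where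
  "resolved \<sigma> \<phi> = (if is_singleton (possible \<sigma> \<phi>) then Some (the_elem (possible \<sigma> \<phi>)) else None)"

definition fork :: "'b rel \<Rightarrow> 'b \<Rightarrow> 'b \<times> 'b \<Rightarrow> bool" where
  "fork \<phi> y = (\<lambda>(s1, s2). s1 \<in> B \<and> s2 \<in> B \<and> (s1, y) \<in> \<phi> \<and> (\<exists>y2. y2 \<noteq> y \<and> (s2, y2) \<in> \<phi>))"

fun carrier :: "(('q, 'b) carrier_state, 'a, unit) local_trans" where
  "carrier To_End \<sigma> _ z = (if \<sigma> = Dollar then Some (Annotate \<iota>, 0, 0) else Some (To_End, 0, 1))"
| "carrier (Annotate \<beta>) \<sigma> _ z = (if \<sigma> = Cent then Some (Carry q0 \<beta>, 0, 0) else Some (Annotate (g \<sigma> \<beta>), 0, -1))"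
| "carrier (Carry q \<beta>) \<sigma> _ z = (case \<delta> q \<sigma> \<beta> z of None \<Rightarrow> None | Some (p, c, d) \<Rightarrow>
     if d = 0 then Some (Carry p \<beta>, c, 0)
     else if d = 1 then Some (Recover (p, \<beta>, None), c, 1)
     else Some (Recover (p, g \<sigma> \<beta>, Some \<beta>), c, 0))"
| "carrier (Recover k) \<sigma> _ z = (let \<phi> = candidates \<sigma> (known k) in case resolved \<sigma> \<phi> of
       Some y \<Rightarrow> Some (Recovered k y, 0, 0)
     | None \<Rightarrow> if \<sigma> = Dollar then None else Some (Search k \<phi>, 0, 1))"
| "carrier (Search k \<phi>) \<sigma> _ z = (let \<phi>' = pull_back \<sigma> \<phi> in case resolved \<sigma> \<phi>' of
       Some y \<Rightarrow> if \<sigma> \<noteq> Cent \<and> (\<exists>p. fork \<phi> y p)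
         then (case SOME p. fork \<phi> y p of (s1, s2) \<Rightarrow> Some (Merge k s1 s2, 0, -1)) else None
     | None \<Rightarrow> if \<sigma> = Dollar then None else Some (Search k \<phi>', 0, 1))"
| "carrier (Merge k s1 s2) \<sigma> _ z = (if g \<sigma> s1 = g \<sigma> s2 then Some (Recovered k s1, 0, 0)
     else if \<sigma> = Cent then None else Some (Merge k (g \<sigma> s1) (g \<sigma> s2), 0, -1))"
| "carrier (Recovered k y) \<sigma> _ z = (case k of
       (p, X, None) \<Rightarrow> Some (Carry p y, 0, 0)
     | (p, X, Some \<beta>) \<Rightarrow> if y = \<beta> \<and> \<sigma> \<noteq> Cent then Some (Carry p X, 0, -1) else None)"

definition tasks :: "('q, 'b) task set" where
  "tasks = Q \<times> B \<times> insert None (Some ` B)"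

definition carrier_states :: "('q, 'b) carrier_state set" where
  "carrier_states = insert To_End (Annotate ` B) \<union> (\<lambda>(q, \<beta>). Carry q \<beta>) ` (Q \<times> B) \<union> Recover ` tasks
     \<union> (\<lambda>(k, \<phi>). Search k \<phi>) ` (tasks \<times> Pow (B \<times> B)) \<union> (\<lambda>(k, s1, s2). Merge k s1 s2) ` (tasks \<times> B \<times> B)
     \<union> (\<lambda>(k, y). Recovered k y) ` (tasks \<times> B)"

lemma mem_carrier_states [simp]:
  "To_End \<in> carrier_states" "Annotate \<beta> \<in> carrier_states \<longleftrightarrow> \<beta> \<in> B"
  "Carry q \<beta> \<in> carrier_states \<longleftrightarrow> q \<in> Q \<and> \<beta> \<in> B" "Recover k \<in> carrier_states \<longleftrightarrow> k \<in> tasks"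
  "Search k \<phi> \<in> carrier_states \<longleftrightarrow> k \<in> tasks \<and> \<phi> \<subseteq> B \<times> B"
  "Merge k s1 s2 \<in> carrier_states \<longleftrightarrow> k \<in> tasks \<and> s1 \<in> B \<and> s2 \<in> B"
  "Recovered k y \<in> carrier_states \<longleftrightarrow> k \<in> tasks \<and> y \<in> B"
  by (auto simp: carrier_states_def image_iff)

lemma mem_tasks: "(p, X, m) \<in> tasks \<longleftrightarrow> p \<in> Q \<and> X \<in> B \<and> (m = None \<or> (\<exists>\<beta>\<in>B. m = Some \<beta>))"
  by (auto simp: tasks_def)

lemma finite_carrier_states: "finite carrier_states"
proof -
  have "finite tasks" using finite_annotations finite_states by (simp add: tasks_def)
  thus ?thesis using finite_annotations finite_states by (simp add: carrier_states_def)
qed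

lemma possible_subset_Range: "possible \<sigma> \<phi> \<subseteq> Range \<phi>"
  by (auto simp: possible_def)

lemma resolved_eq_Some_iff: "resolved \<sigma> \<phi> = Some y \<longleftrightarrow> possible \<sigma> \<phi> = {y}"
proof
  assume "resolved \<sigma> \<phi> = Some y"
  hence "is_singleton (possible \<sigma> \<phi>)" "the_elem (possible \<sigma> \<phi>) = y"
    unfolding resolved_def by (metis option.distinct(1), metis option.distinct(1) option.inject)
  thus "possible \<sigma> \<phi> = {y}" by (metis is_singleton_the_elem)
next
  assume "possible \<sigma> \<phi> = {y}"
  thus "resolved \<sigma> \<phi> = Some y" by (simp add: resolved_def)
qed

lemma resolved_eq_None_iff: "resolved \<sigma> \<phi> = None \<longleftrightarrow> (\<forall>y. possible \<sigma> \<phi> \<noteq> {y})"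
  using resolved_eq_Some_iff by (metis option.exhaust option.distinct(1))

lemma resolved_in_Range: "resolved \<sigma> \<phi> = Some y \<Longrightarrow> y \<in> Range \<phi>"
  using possible_subset_Range[of \<sigma> \<phi>] by (simp add: resolved_eq_Some_iff)

lemma candidates_subset: "candidates \<sigma> X \<subseteq> B \<times> B"
  by (auto simp: candidates_def)

lemma pull_back_subset: "\<phi> \<subseteq> B \<times> B \<Longrightarrow> pull_back \<sigma> \<phi> \<subseteq> B \<times> B"
  by (auto simp: pull_back_def)

lemma fork_exists:
  assumes "y \<in> Range \<phi>" "Range \<phi> \<noteq> {y}" "\<phi> \<subseteq> B \<times> B"
  shows "\<exists>p. fork \<phi> y p"
proof -
  obtain s1 where "(s1, y) \<in> \<phi>" using assms(1) by auto
  moreover obtain s2 y2 where "(s2, y2) \<in> \<phi>" "y2 \<noteq> y" using assms(1,2) by auto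
  ultimately show ?thesis using assms(3) unfolding fork_def by (intro exI[of _ "(s1, s2)"]) auto
qed

lemma carrier_legal_Search:
  assumes "Search k \<phi> \<in> carrier_states" "carrier (Search k \<phi>) \<sigma> \<beta> z = Some m"
  shows "m \<in> legal_moves carrier_states \<sigma>"
proof (cases "resolved \<sigma> (pull_back \<sigma> \<phi>)")
  case None
  thus ?thesis using assms pull_back_subset[of \<phi> \<sigma>]
    by (auto simp: mem_legal_moves incs_def leaves_tape_def Let_def split: if_splits)
next
  case (Some y)
  hence fork: "\<sigma> \<noteq> Cent" "\<exists>p. fork \<phi> y p" using assms by (auto simp: Let_def split: if_splits)
  obtain s1 s2 where s: "(SOME p. fork \<phi> y p) = (s1, s2)" by (meson surj_pair)
  have "fork \<phi> y (s1, s2)" using someI_ex[OF fork(2)] s by simp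
  thus ?thesis using assms Some fork s
    by (auto simp: mem_legal_moves incs_def leaves_tape_def Let_def fork_def)
qed

lemma carrier_legal:
  assumes "r \<in> carrier_states" "carrier r \<sigma> \<beta>' z = Some m"
  shows "m \<in> legal_moves carrier_states \<sigma>"
proof (cases r)
  case (Carry q \<beta>)
  then obtain p c d where trans: "\<delta> q \<sigma> \<beta> z = Some (p, c, d)" using assms(2) by (auto split: option.splits)
  have "q \<in> Q" using assms(1) Carry by simp
  thus ?thesis using trans_legalD[OF _ trans] assms Carry trans update_closed[of \<beta> \<sigma>]
    by (auto simp: mem_legal_moves mem_tasks incs_def leaves_tape_def split: if_splits)
next
  case (Recover k)
  thus ?thesis using assms candidates_subset[of \<sigma> "known k"] resolved_in_Range[of \<sigma> "candidates \<sigma> (known k)"]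
    by (auto simp: mem_legal_moves incs_def leaves_tape_def Let_def split: option.splits if_splits)
next
  case (Search k \<phi>)
  thus ?thesis using carrier_legal_Search assms by blast
next
  case (Recovered k y)
  obtain p X n where "k = (p, X, n)" by (cases k)
  thus ?thesis using assms Recovered
    by (cases n) (auto simp: mem_legal_moves mem_tasks incs_def leaves_tape_def split: if_splits)
qed (use assms update_closed end_annotation init_state in
    \<open>auto simp: mem_legal_moves incs_def leaves_tape_def split: if_splits\<close>)

sublocale carried: local_machine carrier carrier_states
  by unfold_locales (use finite_carrier_states carrier_legal in auto)

abbreviation carrier_step :: "'a list \<Rightarrow> ('q, 'b) carrier_state config \<Rightarrow> ('q, 'b) carrier_state config option" where
  "carrier_step x \<equiv> local_step carrier x (\<lambda>_. ())"

abbreviation carrier_steps :: "'a list \<Rightarrow> ('q, 'b) carrier_state config rel" where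
  "carrier_steps x \<equiv> step_rel carrier carrier_states x (\<lambda>_. ())"

subsection \<open>The working states between two steps\<close>

fun is_carry :: "('q, 'b) carrier_state \<Rightarrow> bool" where
  "is_carry (Carry q \<beta>) = True"
| "is_carry _ = False"

definition detour :: "'a list \<Rightarrow> ('q, 'b) carrier_state config rel" where
  "detour x = {(u, v) \<in> carrier_steps x. \<not> is_carry (fst u) \<and> \<not> is_carry (fst v)}"

fun progress :: "'a list \<Rightarrow> ('q, 'b) carrier_state config \<Rightarrow> int" where
  "progress x (To_End, a, b) = b"
| "progress x (Annotate \<beta>, a, b) = 2 * (int (length x) + 2) - b"
| "progress x (Carry q \<beta>, a, b) = 0"
| "progress x (Recover k, a, b) = 0"
| "progress x (Search k \<phi>, a, b) = b"
| "progress x (Merge k s1 s2, a, b) = 2 * (int (length x) + 2) - b"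
| "progress x (Recovered k y, a, b) = 3 * (int (length x) + 2)"

lemma progress_detour:
  assumes "(u, v) \<in> detour x"
  shows "0 \<le> progress x u" "progress x u < progress x v" "progress x v \<le> 3 * (int (length x) + 2)"
proof -
  have step: "(u, v) \<in> carrier_steps x" "\<not> is_carry (fst u)" "\<not> is_carry (fst v)"
    using assms by (auto simp: detour_def)
  have bounds: "0 \<le> progress x w \<and> progress x w \<le> 3 * (int (length x) + 2)"
    if "w \<in> configs carrier_states x" for w
    using that by (cases w; cases "fst w") (auto simp: mem_configs)
  show "0 \<le> progress x u" "progress x v \<le> 3 * (int (length x) + 2)"
    using bounds carried.step_rel_in_configs[OF step(1)] by blast+
  obtain r a b r' c d where u: "u = (r, a, b)" "v = (r', a + c, b + d)" "on_tape x b"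
    and trans: "carrier r (letter_at x b) () (a = 0) = Some (r', c, d)" using step(1) by (rule step_relE)
  show "progress x u < progress x v" using u step(2,3) trans
    by (cases r) (auto simp: Let_def split: if_splits option.splits prod.splits)
qed

lemma wf_detour: "wf (detour x)"
proof (rule wf_subset[OF wf_measure])
  show "detour x \<subseteq> Wellfounded.measure (\<lambda>u. nat (progress x u))" using progress_detour by fastforce
qed

lemma wf_detour_converse: "wf ((detour x)\<inverse>)"
proof (rule wf_subset[OF wf_measure])
  show "(detour x)\<inverse> \<subseteq> Wellfounded.measure (\<lambda>u. nat (3 * (int (length x) + 2) - progress x u))"
    using progress_detour by fastforce
qed

subsection \<open>Recovering the annotation\<close>

lemma annotation_in:
  assumes "on_tape x b"
  shows "\<gamma> x b \<in> B"
proof -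
  have "b \<le> last_position x" "0 \<le> b" using assms by auto
  thus ?thesis
  proof (induction b rule: int_le_induct)
    case base
    show ?case by (simp add: annotation_last end_annotation)
  next
    case (step b)
    thus ?case using annotation_step[of b x] update_closed by simp
  qed
qed

primrec search_rel :: "'a list \<Rightarrow> int \<Rightarrow> 'b \<Rightarrow> nat \<Rightarrow> 'b rel" where
  "search_rel x b X 0 = candidates (letter_at x b) X"
| "search_rel x b X (Suc j) = pull_back (letter_at x (b + int j + 1)) (search_rel x b X j)"

lemma search_rel_subset: "search_rel x b X j \<subseteq> B \<times> B"
  by (induction j) (auto simp: candidates_def pull_back_def)

lemma single_valued_search_rel: "single_valued (search_rel x b X j)"
  by (induction j) (auto simp: single_valued_def candidates_def pull_back_def)

lemma search_rel_candidate: "(s, y) \<in> search_rel x b X j \<Longrightarrow> y \<in> B \<and> g (letter_at x b) y = X"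
  by (induction j arbitrary: s) (auto simp: candidates_def pull_back_def)

lemma annotation_search_rel:
  assumes "0 < b" "b + int j \<le> last_position x"
  shows "(\<gamma> x (b + int j), \<gamma> x b) \<in> search_rel x b (\<gamma> x (b - 1)) j"
  using assms(2)
proof (induction j)
  case 0
  thus ?case using assms annotation_step[of b x] annotation_in[of b x] by (simp add: candidates_def)
next
  case (Suc j)
  have "\<gamma> x (b + int j) = g (letter_at x (b + int j + 1)) (\<gamma> x (b + int j + 1))"
    using annotation_step[of "b + int j + 1" x] Suc.prems assms(1) by simp
  thus ?case using Suc assms(1) annotation_in[of "b + int j + 1" x]
    by (simp add: pull_back_def algebra_simps)
qed

lemma annotation_possible:
  assumes "0 < b" "b + int j \<le> last_position x"
  shows "\<gamma> x b \<in> possible (letter_at x (b + int j)) (search_rel x b (\<gamma> x (b - 1)) j)"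
  using annotation_search_rel[OF assms] assms annotation_last[of x]
  by (auto simp: possible_def letter_at_eq_Dollar_iff)

inductive recovery :: "'a list \<Rightarrow> ('q, 'b) task \<Rightarrow> int \<Rightarrow> int \<Rightarrow> ('q, 'b) carrier_state config \<Rightarrow> bool"
  for x k a b where
  start: "recovery x k a b (Recover k, a, b)"
| search: "b + int j \<le> int (length x) \<Longrightarrow> (\<And>y. Range (search_rel x b (known k) j) \<noteq> {y}) \<Longrightarrow>
    recovery x k a b (Search k (search_rel x b (known k) j), a, b + int j + 1)"
| merge: "b + int j \<le> int (length x) \<Longrightarrow> (s1, y) \<in> search_rel x b (known k) j \<Longrightarrow>
    (s2, y') \<in> search_rel x b (known k) j \<Longrightarrow> y \<noteq> y' \<Longrightarrow> (known k = \<gamma> x (b - 1) \<Longrightarrow> y = \<gamma> x b) \<Longrightarrow>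
    recovery x k a b (Merge k s1 s2, a, b + int j)"
| finish: "y \<in> B \<Longrightarrow> g (letter_at x b) y = known k \<Longrightarrow> (known k = \<gamma> x (b - 1) \<Longrightarrow> y = \<gamma> x b) \<Longrightarrow>
    recovery x k a b (Recovered k y, a, b)"

definition recovery_progress :: "'a list \<Rightarrow> ('q, 'b) task \<Rightarrow> int \<Rightarrow> int \<Rightarrow> ('q, 'b) carrier_state config \<Rightarrow> bool" where
  "recovery_progress x k a b u \<longleftrightarrow> (case carrier_step x u of
     Some v \<Rightarrow> recovery x k a b v | None \<Rightarrow> known k \<noteq> \<gamma> x (b - 1))"

lemma recovery_unresolved:
  assumes b: "0 < b" "b + int j \<le> last_position x"
    and none: "resolved (letter_at x (b + int j)) (search_rel x b (known k) j) = None"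
  shows "if letter_at x (b + int j) = Dollar then known k \<noteq> \<gamma> x (b - 1)
    else recovery x k a b (Search k (search_rel x b (known k) j), a, b + int j + 1)"
proof (cases "letter_at x (b + int j) = Dollar")
  case True
  have "known k \<noteq> \<gamma> x (b - 1)"
  proof
    assume "known k = \<gamma> x (b - 1)"
    hence "possible Dollar (search_rel x b (known k) j) = {\<gamma> x b}"
      using annotation_possible[OF b] single_valued_search_rel[of x b "known k" j] True
      by (auto simp: possible_def dest: single_valuedD)
    thus False using none True by (simp add: resolved_eq_None_iff)
  qed
  thus ?thesis using True by simp
next
  case False
  hence "b + int j \<le> int (length x)" using b letter_at_eq_Dollar_iff[of "b + int j" x] by simp
  moreover have "Range (search_rel x b (known k) j) \<noteq> {y}" for y
    using none False by (simp add: resolved_eq_None_iff possible_def)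
  ultimately show ?thesis using False by (simp add: recovery.search)
qed

lemma resolved_correct:
  assumes "0 < b" "b + int j \<le> last_position x" "known k = \<gamma> x (b - 1)"
    and "resolved (letter_at x (b + int j)) (search_rel x b (known k) j) = Some y"
  shows "y = \<gamma> x b"
  using annotation_possible[OF assms(1,2)] assms(3,4) by (simp add: resolved_eq_Some_iff)

lemma recovery_progress_Recover:
  assumes "0 < b" "b \<le> last_position x"
  shows "recovery_progress x k a b (Recover k, a, b)"
proof (cases "resolved (letter_at x b) (candidates (letter_at x b) (known k))")
  case None
  thus ?thesis using recovery_unresolved[of b 0 x k a] assms
    by (auto simp: recovery_progress_def local_step_def split: if_splits)
next
  case (Some y)
  have "y \<in> B \<and> g (letter_at x b) y = known k"
    using resolved_in_Range[OF Some] search_rel_candidate[of _ y x b "known k" 0] by auto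
  moreover have "known k = \<gamma> x (b - 1) \<Longrightarrow> y = \<gamma> x b"
    using resolved_correct[of b 0 x k y] assms Some by simp
  ultimately show ?thesis using Some by (simp add: recovery_progress_def local_step_def recovery.finish)
qed

lemma recovery_progress_Search:
  assumes b: "0 < b" "b + int j \<le> int (length x)" and range: "\<And>y. Range (search_rel x b (known k) j) \<noteq> {y}"
  shows "recovery_progress x k a b (Search k (search_rel x b (known k) j), a, b + int j + 1)"
proof -
  let ?\<sigma> = "letter_at x (b + int j + 1)" and ?\<phi> = "search_rel x b (known k) j"
  show ?thesis
  proof (cases "resolved ?\<sigma> (pull_back ?\<sigma> ?\<phi>)")
    case None
    thus ?thesis using recovery_unresolved[of b "Suc j" x k a] b
      by (auto simp: recovery_progress_def local_step_def algebra_simps split: if_splits)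
  next
    case (Some y)
    have "y \<in> Range ?\<phi>" using resolved_in_Range[OF Some] by (auto simp: pull_back_def)
    hence ex: "\<exists>p. fork ?\<phi> y p" using fork_exists[OF _ range search_rel_subset] by blast
    obtain s1 s2 where s: "(SOME p. fork ?\<phi> y p) = (s1, s2)" by (meson surj_pair)
    have "fork ?\<phi> y (s1, s2)" using someI_ex[OF ex] s by simp
    then obtain y' where fork: "(s1, y) \<in> ?\<phi>" "(s2, y') \<in> ?\<phi>" "y \<noteq> y'" by (auto simp: fork_def)
    have "known k = \<gamma> x (b - 1) \<Longrightarrow> y = \<gamma> x b"
      using resolved_correct[of b "Suc j" x k y] b Some by (simp add: algebra_simps)
    hence "recovery x k a b (Merge k s1 s2, a, b + int j)" using recovery.merge[OF b(2) fork] by simp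
    moreover have "?\<sigma> \<noteq> Cent" using b by (simp add: letter_at_eq_Cent_iff)
    ultimately show ?thesis using Some ex s by (simp add: recovery_progress_def local_step_def)
  qed
qed

lemma recovery_progress_Merge:
  assumes b: "0 < b" "b + int j \<le> int (length x)"
    and fork: "(s1, y) \<in> search_rel x b (known k) j" "(s2, y') \<in> search_rel x b (known k) j" "y \<noteq> y'"
    and true: "known k = \<gamma> x (b - 1) \<Longrightarrow> y = \<gamma> x b"
  shows "recovery_progress x k a b (Merge k s1 s2, a, b + int j)"
proof (cases j)
  case 0
  hence s: "s1 = y" "s2 = y'" "g (letter_at x b) y = known k" "g (letter_at x b) y' = known k" "y \<in> B"
    using fork by (auto simp: candidates_def)
  hence "recovery x k a b (Recovered k y, a, b)" using true by (intro recovery.finish) auto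
  thus ?thesis using 0 s by (simp add: recovery_progress_def local_step_def)
next
  case (Suc i)
  let ?\<sigma> = "letter_at x (b + int j)"
  have s: "(g ?\<sigma> s1, y) \<in> search_rel x b (known k) i" "(g ?\<sigma> s2, y') \<in> search_rel x b (known k) i"
    using fork Suc by (auto simp: pull_back_def algebra_simps)
  hence "g ?\<sigma> s1 \<noteq> g ?\<sigma> s2" using single_valued_search_rel fork(3) by (metis single_valuedD)
  moreover have "?\<sigma> \<noteq> Cent" using b by (simp add: letter_at_eq_Cent_iff)
  moreover have "recovery x k a b (Merge k (g ?\<sigma> s1) (g ?\<sigma> s2), a, b + int i)"
    using recovery.merge[OF _ s fork(3) true] b(2) Suc by simp
  ultimately show ?thesis using Suc by (simp add: recovery_progress_def local_step_def)
qed

lemma recovery_step: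
  assumes "recovery x k a b u" "0 < b" "b \<le> last_position x"
  shows "(\<exists>y. u = (Recovered k y, a, b)) \<or> recovery_progress x k a b u"
  using assms(1)
  by cases (use assms recovery_progress_Recover recovery_progress_Search recovery_progress_Merge in blast)+

lemma recovery_not_carry: "recovery x k a b u \<Longrightarrow> \<not> is_carry (fst u)"
  by (cases rule: recovery.cases) auto

lemma recovery_succeeds:
  assumes "recovery x k a b u" "u \<in> configs carrier_states x" "0 < b" "b \<le> last_position x"
    and "known k = \<gamma> x (b - 1)"
  shows "(u, (Recovered k (\<gamma> x b), a, b)) \<in> (carrier_steps x)\<^sup>*"
  using wf_detour_converse[of x] assms(1,2)
proof (induction u rule: wf_induct_rule)
  case (less u)
  consider y where "u = (Recovered k y, a, b)" | v where "carrier_step x u = Some v" "recovery x k a b v"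
    using recovery_step[OF less(2) assms(3,4)] assms(5)
    by (auto simp: recovery_progress_def split: option.splits)
  thus ?case
  proof cases
    case 1
    have "y = \<gamma> x b" using less(2)[unfolded 1] assms(5) by (cases rule: recovery.cases) auto
    thus ?thesis using 1 by simp
  next
    case 2
    have step: "(u, v) \<in> carrier_steps x" using 2(1) less(3) by (simp add: step_rel_def)
    have "(v, u) \<in> (detour x)\<inverse>"
      using step recovery_not_carry[OF less(2)] recovery_not_carry[OF 2(2)] by (simp add: detour_def)
    from less(1)[OF this 2(2) carried.step_rel_in_configs(2)[OF step]] step
    show ?thesis by (rule converse_rtrancl_into_rtrancl[rotated])
  qed
qed

lemma Recover_forward:
  assumes "(u, (Recover k, a, b)) \<in> carrier_steps x" "0 < b" "b \<le> last_position x" "known k = \<gamma> x (b - 1)"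
    and "((Recovered k (\<gamma> x b), a, b), v) \<in> carrier_steps x"
  shows "(u, v) \<in> (carrier_steps x)\<^sup>*"
  using recovery_succeeds[OF recovery.start carried.step_rel_in_configs(2)[OF assms(1)] assms(2-4)] assms(1,5)
  by (meson converse_rtrancl_into_rtrancl rtrancl_into_rtrancl)

definition embed :: "'a list \<Rightarrow> 'q config \<Rightarrow> ('q, 'b) carrier_state \<times> int \<times> int" where
  "embed x u = (Carry (fst u) (\<gamma> x (position u)), snd u)"

lemma embed_step:
  assumes "(u, v) \<in> steps x"
  shows "(embed x u, embed x v) \<in> (carrier_steps x)\<^sup>*"
proof -
  obtain q a b p c d where u: "u = (q, a, b)" "v = (p, a + c, b + d)" "q \<in> Q" "on_tape x b"
    and trans: "\<delta> q (letter_at x b) (\<gamma> x b) (a = 0) = Some (p, c, d)" using assms by (rule step_relE)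
  have v: "p \<in> Q" "on_tape x (b + d)" using step_rel_in_configs(2)[OF assms] u(2) by (simp_all add: mem_configs)
  note annotations = annotation_in[OF u(4)] annotation_in[OF v(2)]
  have "d \<in> incs" using trans_legalD(3)[OF u(3) trans] .
  then consider "d = 0" | "d = 1" | "d = -1" by (auto simp: incs_def)
  thus ?thesis
  proof cases
    case 1
    have "(embed x u, embed x v) \<in> carrier_steps x"
      using trans 1 u annotations by (simp add: step_rel_iff embed_def)
    thus ?thesis by simp
  next
    case 2
    show ?thesis
      by (rule Recover_forward[where k = "(p, \<gamma> x b, None)" and a = "a + c" and b = "b + 1"])
        (use trans 2 u v annotations in \<open>simp_all add: step_rel_iff embed_def mem_tasks\<close>)
  next
    case 3
    have b: "0 < b" "b \<le> last_position x" using u(4) v(2) 3 by auto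
    show ?thesis
      by (rule Recover_forward[where k = "(p, \<gamma> x (b - 1), Some (\<gamma> x b))" and a = "a + c" and b = b])
        (use trans 3 u v b annotations annotation_step[OF b] in
          \<open>simp_all add: step_rel_iff embed_def mem_tasks letter_at_eq_Cent_iff\<close>)
  qed
qed

lemma embed_steps: "(u, v) \<in> (steps x)\<^sup>* \<Longrightarrow> (embed x u, embed x v) \<in> (carrier_steps x)\<^sup>*"
  by (induction rule: rtrancl_induct) (auto intro: rtrancl_trans dest: embed_step)

lemma walk_to_end: "k \<le> length x + 1 \<Longrightarrow> ((To_End, 0, 0), (To_End, 0, int k)) \<in> (carrier_steps x)\<^sup>*"
proof (induction k)
  case (Suc k)
  hence "((To_End, 0, int k), (To_End, 0, int (Suc k))) \<in> carrier_steps x"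
    using letter_at_eq_Dollar_iff[of "int k" x] by (simp add: step_rel_iff)
  thus ?case using Suc by (meson Suc_leD rtrancl.rtrancl_into_rtrancl)
qed simp

lemma annotate_from_end:
  "k \<le> length x + 1 \<Longrightarrow> ((Annotate \<iota>, 0, last_position x),
     (Annotate (\<gamma> x (last_position x - int k)), 0, last_position x - int k)) \<in> (carrier_steps x)\<^sup>*"
proof (induction k)
  case (Suc k)
  let ?b = "last_position x - int k"
  have "((Annotate \<iota>, 0, last_position x), (Annotate (\<gamma> x ?b), 0, ?b)) \<in> (carrier_steps x)\<^sup>*"
    using Suc by simp
  also have "((Annotate (\<gamma> x ?b), 0, ?b), (Annotate (\<gamma> x (?b - 1)), 0, ?b - 1)) \<in> carrier_steps x"
    using Suc.prems letter_at_eq_Cent_iff[of ?b x] annotation_step[of ?b x] annotation_in[of ?b x]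
    by (auto simp: step_rel_iff)
  finally show ?case by (simp add: algebra_simps)
qed (simp add: annotation_last)

lemma embed_init: "((To_End, 0, 0), embed x (q0, 0, 0)) \<in> (carrier_steps x)\<^sup>*"
proof -
  have "((To_End, 0, 0), (To_End, 0, last_position x)) \<in> (carrier_steps x)\<^sup>*"
    using walk_to_end[of "length x + 1" x] by (simp add: algebra_simps)
  also have "((To_End, 0, last_position x), (Annotate \<iota>, 0, last_position x)) \<in> carrier_steps x"
    using letter_at_eq_Dollar_iff[of "last_position x" x] by (simp add: step_rel_iff)
  also have "((Annotate \<iota>, 0, last_position x), (Annotate (\<gamma> x 0), 0, 0)) \<in> (carrier_steps x)\<^sup>*"
    using annotate_from_end[of "length x + 1" x] by simp
  also have "((Annotate (\<gamma> x 0), 0, 0), embed x (q0, 0, 0)) \<in> carrier_steps x"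
    using annotation_in[of 0 x] letter_at_eq_Cent_iff[of 0 x] by (simp add: step_rel_iff embed_def)
  finally show ?thesis .
qed

subsection \<open>Predecessors of correctly annotated configurations\<close>

abbreviation working_steps :: "'a list \<Rightarrow> ('q, 'b) carrier_state config rel" where
  "working_steps x \<equiv> {(u, v) \<in> carrier_steps x. \<not> is_carry (fst u)}"

lemma recovery_exit:
  assumes "(u, t) \<in> (working_steps x)\<^sup>*" "recovery x k a b u" "is_carry (fst t)" "0 < b" "b \<le> last_position x"
  shows "\<exists>y. recovery x k a b (Recovered k y, a, b) \<and> ((Recovered k y, a, b), t) \<in> carrier_steps x"
  using assms(1,2)
proof (induction rule: converse_rtrancl_induct)
  case base
  thus ?case using recovery_not_carry assms(3) by blast
next
  case (step u v)
  have uv: "(u, v) \<in> carrier_steps x" using step(1) by simp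
  show ?case
  proof (cases "\<exists>y. u = (Recovered k y, a, b)")
    case True
    hence "is_carry (fst v)" using uv by (cases k) (auto simp: step_rel_iff split: option.splits if_splits)
    hence "v = t" using step(2) by (auto elim: converse_rtranclE)
    thus ?thesis using True uv step(4) by auto
  next
    case False
    hence "recovery x k a b v" using recovery_step[OF step(4) assms(4,5)] uv
      by (auto simp: recovery_progress_def step_rel_def)
    thus ?thesis by (rule step(3))
  qed
qed

lemma Recover_backward:
  assumes "((Recover (p, X, m), a, b), embed x w) \<in> (working_steps x)\<^sup>*" and b: "0 < b" "b \<le> last_position x"
  shows "X = \<gamma> x (b - 1) \<and> (case m of None \<Rightarrow> w = (p, a, b) | Some \<beta> \<Rightarrow> \<beta> = \<gamma> x b \<and> w = (p, a, b - 1))"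
proof -
  obtain q a' b' where w: "w = (q, a', b')" by (cases w)
  obtain y where y: "recovery x (p, X, m) a b (Recovered (p, X, m) y, a, b)"
    "((Recovered (p, X, m) y, a, b), embed x w) \<in> carrier_steps x"
    using recovery_exit[OF assms(1) recovery.start _ b] by (auto simp: embed_def)
  have candidate: "g (letter_at x b) y = X" "X = \<gamma> x (b - 1) \<Longrightarrow> y = \<gamma> x b"
    using y(1) by (auto elim: recovery.cases)
  show ?thesis
  proof (cases m)
    case None
    thus ?thesis using y(2) candidate(1) annotation_step[OF b] by (auto simp: step_rel_iff embed_def w)
  next
    case (Some \<beta>)
    thus ?thesis using y(2) candidate(2) by (auto simp: step_rel_iff embed_def w split: if_splits)
  qed
qed

lemma carry_predecessor:
  assumes uv: "(u, v) \<in> carrier_steps x" "is_carry (fst u)" and path: "(v, embed x w) \<in> (working_steps x)\<^sup>*"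
  shows "\<exists>w'. u = embed x w' \<and> (w', w) \<in> steps x"
proof -
  obtain q \<beta> a b where u: "u = (Carry q \<beta>, a, b)" using uv(2) by (cases u; cases "fst u") auto
  have q: "q \<in> Q" "on_tape x b" using uv(1) by (auto simp: u step_rel_iff)
  obtain p c d where trans: "\<delta> q (letter_at x b) \<beta> (a = 0) = Some (p, c, d)"
    using uv(1) by (auto simp: u step_rel_iff split: option.splits)
  note legal = trans_legalD[OF q(1) trans]
  have "\<beta> = \<gamma> x b \<and> w = (p, a + c, b + d)"
  proof -
    consider "d = 0" | "d = 1" | "d = -1" using legal(3) by (auto simp: incs_def)
    thus ?thesis
    proof cases
      case 1
      have v: "v = (Carry p \<beta>, a + c, b)" using uv(1) trans 1 by (simp add: u step_rel_iff)
      have "embed x w = v" using path by (auto simp: v elim: converse_rtranclE)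
      thus ?thesis using v 1 by (cases w) (auto simp: embed_def)
    next
      case 2
      have v: "v = (Recover (p, \<beta>, None), a + c, b + 1)" using uv(1) trans 2 by (simp add: u step_rel_iff)
      have "b + 1 \<le> last_position x" using carried.step_rel_in_configs(2)[OF uv(1)] by (simp add: v mem_configs)
      thus ?thesis using Recover_backward[OF path[unfolded v]] q(2) 2 by simp
    next
      case 3
      have v: "v = (Recover (p, g (letter_at x b) \<beta>, Some \<beta>), a + c, b)"
        using uv(1) trans 3 by (simp add: u step_rel_iff)
      have "0 < b" using legal(4) 3 q(2) leaves_tape_iff[OF q(2) legal(3)] by auto
      thus ?thesis using Recover_backward[OF path[unfolded v]] q(2) 3 by simp
    qed
  qed
  thus ?thesis using trans q by (intro exI[of _ "(q, a, b)"]) (auto simp: u embed_def step_rel_iff)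
qed

lemma embed_acc:
  assumes "w \<in> Wellfounded.acc (steps x)"
  shows "embed x w \<in> Wellfounded.acc (carrier_steps x)"
proof (rule acc_simulation[OF assms])
  show "wf {(u, v) \<in> carrier_steps x. u \<notin> {u. is_carry (fst u)} \<and> v \<notin> {u. is_carry (fst u)}}"
    using wf_detour[of x] by (simp add: detour_def)
  show "\<exists>w'. u = embed x w' \<and> (w', w) \<in> steps x"
    if "(u, v) \<in> carrier_steps x" "u \<in> {u. is_carry (fst u)}"
      "(v, embed x w) \<in> {(u, v) \<in> carrier_steps x. u \<notin> {u. is_carry (fst u)}}\<^sup>*" for u v w
    using carry_predecessor[of u v x w] that by simp
qed

definition carrier_final :: "'q set \<Rightarrow> ('q, 'b) carrier_state set" where
  "carrier_final F = (\<lambda>(q, \<beta>). Carry q \<beta>) ` (F \<times> B)"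

lemma embed_final:
  assumes "((q0, 0, 0), u) \<in> (steps x)\<^sup>*" "fst u \<in> F"
  shows "fst (embed x u) \<in> carrier_final F"
  using assms(2) annotation_in run_in_configs[OF assms(1)]
  by (auto simp: embed_def carrier_final_def configs_def)

theorem tame_decider_carrier:
  "tame_decider carrier carrier_states To_End (carrier_final A) (carrier_final R) (\<lambda>_ _. ()) L"
proof unfold_locales
  show "carrier q \<sigma> \<beta> z = None" if "q \<in> carrier_final A \<union> carrier_final R" for q \<sigma> \<beta> z
    using that final_trans by (auto simp: carrier_final_def)
  show "carrier_final A \<inter> carrier_final R = {}" using disjoint by (auto simp: carrier_final_def)
  show "To_End \<notin> carrier_final A \<union> carrier_final R" by (auto simp: carrier_final_def)
  show "carrier_final A \<subseteq> carrier_states" "carrier_final R \<subseteq> carrier_states"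
    using accepting rejecting by (auto simp: carrier_final_def)
next
  fix x
  obtain u where u: "((q0, 0, 0), u) \<in> (steps x)\<^sup>*" "fst u \<in> (if x \<in> L then A else R)" using decides by blast
  have run: "((To_End, 0, 0), embed x u) \<in> (carrier_steps x)\<^sup>*"
    using embed_init embed_steps[OF u(1)] by (rule rtrancl_trans)
  have final: "fst (embed x u) \<in> (if x \<in> L then carrier_final A else carrier_final R)"
    using embed_final[OF u(1), of A] embed_final[OF u(1), of R] u(2) by auto
  show "\<exists>v. ((To_End, 0, 0), v) \<in> (carrier_steps x)\<^sup>* \<and>
      fst v \<in> (if x \<in> L then carrier_final A else carrier_final R)"
    using run final by blast
  have "embed x u \<in> Wellfounded.acc (carrier_steps x)" using embed_acc run_acc u(1) by blast
  thus "\<exists>v. ((To_End, 0, 0), v) \<in> (carrier_steps x)\<^sup>* \<and> fst v \<in> carrier_final A \<union> carrier_final R \<and>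
      v \<in> Wellfounded.acc (carrier_steps x)"
    using run final by (intro exI[of _ "embed x u"]) (auto split: if_splits)
qed simp

end

section \<open>Cutting infinite predecessor paths\<close>

text \<open>\<open>Test_Node\<close> and \<open>Test_Try\<close> tour a predecessor tree like \<open>Node\<close> and \<open>Try\<close>; their flag records
  whether counter value 0 has been met.\<close>

datatype 'q guard_state = Run 'q | Test_Node bool 'q nat | Test_Try bool 'q nat

abbreviation site :: "'q \<times> int \<times> 'p \<Rightarrow> 'q \<times> 'p" where "site u \<equiv> (fst u, position u)"

locale cycle_guard = decider \<delta> Q q0 A R "\<lambda>_ _. ()" L
  for \<delta> :: "('q, 'a, unit) local_trans" and Q :: "'q set" and q0 :: 'q
    and A R :: "'q set" and L :: "'a list set"
begin

subsection \<open>Marked sites\<close>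

definition flow :: "'a list \<Rightarrow> ('q \<times> int) rel" where
  "flow x = {((q, b), (p, b')). q \<in> Q \<and> on_tape x b \<and> (\<exists>c. \<delta> q (letter_at x b) () False = Some (p, c, b' - b))}"

definition flow_from :: "'a list \<Rightarrow> int \<Rightarrow> ('q \<times> int) rel" where
  "flow_from x l = {(u, v) \<in> flow x. l \<le> snd u \<and> l \<le> snd v}"

text \<open>\<open>returns x b\<close> relates the state in which position \<open>b\<close> is left to the right to the state in which
  it is entered again.\<close>

definition returns :: "'a list \<Rightarrow> int \<Rightarrow> 'q rel" where
  "returns x b = {(p, p').
     \<exists>r. ((p, b + 1), (r, b + 1)) \<in> (flow_from x (b + 1))\<^sup>* \<and> ((r, b + 1), (p', b)) \<in> flow x}"

definition first_return :: "'a tsym \<Rightarrow> 'q rel \<Rightarrow> 'q rel" where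
  "first_return \<sigma> F = {(p, p'). p \<in> Q \<and>
     ((\<exists>c. \<delta> p \<sigma> () False = Some (p', c, 0)) \<or> (\<exists>r c. \<delta> p \<sigma> () False = Some (r, c, 1) \<and> (r, p') \<in> F))}"

definition returns_left :: "'a tsym \<Rightarrow> 'q rel \<Rightarrow> 'q rel" where
  "returns_left \<sigma> F = {(p, p'). \<exists>r c. (p, r) \<in> (first_return \<sigma> F)\<^sup>* \<and> r \<in> Q \<and> \<delta> r \<sigma> () False = Some (p', c, -1)}"

definition state_rank :: "'q \<Rightarrow> nat" where "state_rank = to_nat_on Q"

definition marked_at :: "'a tsym \<Rightarrow> 'q rel \<Rightarrow> 'q \<Rightarrow> bool" where
  "marked_at \<sigma> F q \<longleftrightarrow> (q, q) \<in> (first_return \<sigma> F)\<^sup>+ \<and>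
     (\<forall>p. (q, p) \<in> (first_return \<sigma> F)\<^sup>+ \<longrightarrow> state_rank q \<le> state_rank p)"

abbreviation returning :: "'a list \<Rightarrow> int \<Rightarrow> 'q rel" where
  "returning x b \<equiv> first_return (letter_at x b) (returns x b)"

abbreviation marked :: "'a list \<Rightarrow> 'q \<times> int \<Rightarrow> bool" where
  "marked x u \<equiv> marked_at (letter_at x (snd u)) (returns x (snd u)) (fst u)"

lemma flow_iff: "((q, b), (p, b')) \<in> flow x \<longleftrightarrow>
    q \<in> Q \<and> on_tape x b \<and> (\<exists>c. \<delta> q (letter_at x b) () False = Some (p, c, b' - b))"
  by (simp add: flow_def)

lemma single_valued_flow: "single_valued (flow x)"
  by (auto simp: single_valued_def flow_def)

lemma flow_in_sites:
  assumes "((q, b), (p, b')) \<in> flow x"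
  shows "q \<in> Q" "p \<in> Q" "on_tape x b" "on_tape x b'" "b' = b - 1 \<or> b' = b \<or> b' = b + 1"
proof -
  obtain c where q: "q \<in> Q" "on_tape x b" and trans: "\<delta> q (letter_at x b) () False = Some (p, c, b' - b)"
    using assms by (auto simp: flow_iff)
  note legal = trans_legalD[OF q(1) trans]
  show "q \<in> Q" "p \<in> Q" "on_tape x b" "on_tape x b'" "b' = b - 1 \<or> b' = b \<or> b' = b + 1"
    using q legal leaves_tape_iff[OF q(2) legal(3)] by (auto simp: incs_def)
qed

lemma finite_flow: "finite (flow x)"
proof (rule finite_subset)
  show "flow x \<subseteq> (Q \<times> {0..last_position x}) \<times> (Q \<times> {0..last_position x})"
    by (auto dest: flow_in_sites)
  show "finite \<dots>" using finite_states by simp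
qed

lemma flow_of_step: "(u, v) \<in> steps x \<Longrightarrow> counter u \<noteq> 0 \<Longrightarrow> (site u, site v) \<in> flow x"
  by (auto elim!: step_relE simp: flow_iff)

lemma flow_from_subset: "flow_from x l \<subseteq> flow x"
  by (auto simp: flow_from_def)

lemma flow_from_antimono: "l \<le> l' \<Longrightarrow> flow_from x l' \<subseteq> flow_from x l"
  by (auto simp: flow_from_def)

lemma flow_from_trancl_ge: "(u, v) \<in> (flow_from x l)\<^sup>+ \<Longrightarrow> l \<le> snd u \<and> l \<le> snd v"
  by (induction rule: trancl_induct) (auto simp: flow_from_def)

definition excursion :: "'a list \<Rightarrow> int \<Rightarrow> 'q \<Rightarrow> 'q \<times> int \<Rightarrow> bool" where
  "excursion x b q v \<longleftrightarrow> (\<exists>r r'. (q, r) \<in> (returning x b)\<^sup>* \<and> ((r, b), (r', b + 1)) \<in> flow x \<and>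
     ((r', b + 1), v) \<in> (flow_from x (b + 1))\<^sup>*)"

lemma excursion_start:
  assumes "(q, s) \<in> (returning x b)\<^sup>*" "((s, b), v) \<in> flow_from x b"
  shows "snd v = b \<and> (q, fst v) \<in> (returning x b)\<^sup>+ \<or> excursion x b q v"
proof -
  obtain s' b' where v: "v = (s', b')" by (cases v)
  have flow: "((s, b), (s', b')) \<in> flow x" "b \<le> b'" using assms(2) by (auto simp: flow_from_def v)
  then consider "b' = b" | "b' = b + 1" using flow_in_sites(5) by force
  thus ?thesis
  proof cases
    case 1
    hence "(s, s') \<in> returning x b" using flow(1) by (auto simp: flow_iff first_return_def)
    thus ?thesis using assms(1) 1 by (auto simp: v)
  next
    case 2
    thus ?thesis using assms(1) flow(1) by (auto simp: v excursion_def)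
  qed
qed

lemma excursion_continue:
  assumes "excursion x b q v" "(v, w) \<in> flow_from x b"
  shows "snd w = b \<and> (q, fst w) \<in> (returning x b)\<^sup>+ \<or> excursion x b q w"
proof -
  obtain r r' where r: "(q, r) \<in> (returning x b)\<^sup>*" "((r, b), (r', b + 1)) \<in> flow x"
    "((r', b + 1), v) \<in> (flow_from x (b + 1))\<^sup>*"
    using assms(1) by (auto simp: excursion_def)
  obtain s j where v: "v = (s, j)" by (cases v)
  obtain s' j' where w: "w = (s', j')" by (cases w)
  have flow: "((s, j), (s', j')) \<in> flow x" "b \<le> j'" using assms(2) by (auto simp: flow_from_def v w)
  have j: "b + 1 \<le> j" using r(3) by (auto simp: v rtrancl_eq_or_trancl dest: flow_from_trancl_ge)
  show ?thesis
  proof (cases "j' = b")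
    case True
    hence "j = b + 1" using flow_in_sites(5)[OF flow(1)] j by auto
    hence "(r', s') \<in> returns x b" using r(3) flow(1) True by (auto simp: returns_def v)
    hence "(r, s') \<in> returning x b" using r(2) by (auto simp: flow_iff first_return_def)
    thus ?thesis using r(1) True by (auto simp: w intro: rtrancl_into_trancl1)
  next
    case False
    hence "(v, w) \<in> flow_from x (b + 1)" using flow j by (auto simp: flow_from_def v w)
    hence "((r', b + 1), w) \<in> (flow_from x (b + 1))\<^sup>*" using r(3) by (rule rtrancl_into_rtrancl[rotated])
    thus ?thesis using r(1,2) by (auto simp: excursion_def)
  qed
qed

lemma flow_from_trancl_cases:
  assumes "((q, b), v) \<in> (flow_from x b)\<^sup>+"
  shows "snd v = b \<and> (q, fst v) \<in> (returning x b)\<^sup>+ \<or> excursion x b q v"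
  using assms
proof (induction rule: trancl_induct)
  case (base v)
  thus ?case using excursion_start[of q q] by simp
next
  case (step v w)
  show ?case using step(3)
  proof
    assume "snd v = b \<and> (q, fst v) \<in> (returning x b)\<^sup>+"
    thus ?thesis using excursion_start[of q "fst v" x b w] step(2)
      by (cases v) (auto intro: trancl_into_rtrancl)
  qed (use excursion_continue step(2) in blast)
qed

lemma excursion_right: "excursion x b q v \<Longrightarrow> b < snd v"
  by (auto simp: excursion_def rtrancl_eq_or_trancl dest: flow_from_trancl_ge)

lemma returning_flow:
  assumes "(p, p') \<in> returning x b" "on_tape x b"
  shows "((p, b), (p', b)) \<in> (flow_from x b)\<^sup>+"
proof -
  have p: "p \<in> Q" using assms by (auto simp: first_return_def)
  consider c where "\<delta> p (letter_at x b) () False = Some (p', c, 0)"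
    | r c where "\<delta> p (letter_at x b) () False = Some (r, c, 1)" "(r, p') \<in> returns x b"
    using assms(1) by (auto simp: first_return_def)
  thus ?thesis
  proof cases
    case 1
    thus ?thesis using p assms by (auto simp: flow_from_def flow_iff intro!: r_into_trancl)
  next
    case 2
    have out: "((p, b), (r, b + 1)) \<in> flow_from x b" using 2 p assms by (auto simp: flow_from_def flow_iff)
    obtain t where t: "((r, b + 1), (t, b + 1)) \<in> (flow_from x (b + 1))\<^sup>*" "((t, b + 1), (p', b)) \<in> flow x"
      using 2 by (auto simp: returns_def)
    have "((r, b + 1), (t, b + 1)) \<in> (flow_from x b)\<^sup>*"
      using t(1) rtrancl_mono[OF flow_from_antimono[of b "b + 1" x]] by auto
    moreover have "((t, b + 1), (p', b)) \<in> flow_from x b" using t(2) by (auto simp: flow_from_def)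
    ultimately show ?thesis using out by (meson rtrancl_into_trancl2 rtrancl_into_rtrancl)
  qed
qed

lemma returning_trancl_iff:
  assumes "on_tape x b"
  shows "(p, p') \<in> (returning x b)\<^sup>+ \<longleftrightarrow> ((p, b), (p', b)) \<in> (flow_from x b)\<^sup>+"
proof
  assume "(p, p') \<in> (returning x b)\<^sup>+"
  thus "((p, b), (p', b)) \<in> (flow_from x b)\<^sup>+"
    by (induction rule: trancl_induct) (auto intro: returning_flow[OF _ assms] trancl_trans)
next
  assume "((p, b), (p', b)) \<in> (flow_from x b)\<^sup>+"
  from flow_from_trancl_cases[OF this] show "(p, p') \<in> (returning x b)\<^sup>+"
    by (auto dest: excursion_right)
qed

lemma returning_rtrancl_iff:
  "on_tape x b \<Longrightarrow> (p, p') \<in> (returning x b)\<^sup>* \<longleftrightarrow> ((p, b), (p', b)) \<in> (flow_from x b)\<^sup>*"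
  by (auto simp: rtrancl_eq_or_trancl returning_trancl_iff)

lemma returns_last: "returns x (last_position x) = {}"
  by (auto simp: returns_def dest: flow_in_sites(3))

lemma returns_minus_one:
  assumes "0 < b" "b \<le> last_position x"
  shows "returns x (b - 1) = returns_left (letter_at x b) (returns x b)"
  using assms by (auto simp: returns_def[of x "b - 1"] returns_left_def returning_rtrancl_iff flow_iff; blast)

lemma returns_left_subset: "returns_left \<sigma> F \<subseteq> Q \<times> Q"
proof clarify
  fix p p' assume "(p, p') \<in> returns_left \<sigma> F"
  then obtain r c where r: "(p, r) \<in> (first_return \<sigma> F)\<^sup>*" "r \<in> Q" "\<delta> r \<sigma> () False = Some (p', c, -1)"
    by (auto simp: returns_left_def)
  have "p \<in> Q" using r(1,2) by (cases rule: converse_rtranclE) (auto simp: first_return_def)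
  thus "p \<in> Q \<and> p' \<in> Q" using trans_legalD(1)[OF r(2,3)] by simp
qed

lemma marked_iff:
  assumes "on_tape x b"
  shows "marked x (q, b) \<longleftrightarrow> ((q, b), (q, b)) \<in> (flow_from x b)\<^sup>+ \<and>
    (\<forall>p. ((q, b), (p, b)) \<in> (flow_from x b)\<^sup>+ \<longrightarrow> state_rank q \<le> state_rank p)"
  by (simp add: marked_at_def returning_trancl_iff[OF assms])

lemma marked_at_trans: "marked_at \<sigma> F q \<Longrightarrow> q \<in> Q \<and> \<delta> q \<sigma> () False \<noteq> None"
  by (auto simp: marked_at_def first_return_def dest!: tranclD)

lemma marked_on_cycle:
  assumes cycle: "(u, u) \<in> (flow x)\<^sup>+"
  shows "\<exists>v. (u, v) \<in> (flow x)\<^sup>* \<and> marked x v"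
proof -
  define orbit where "orbit = {v. (u, v) \<in> (flow x)\<^sup>*}"
  let ?lower = "inv_image (less_than <*lex*> less_than) (\<lambda>w :: 'q \<times> int. (nat (snd w), state_rank (fst w)))"
  have "wf ?lower" by (intro wf_inv_image wf_lex_prod wf_less_than)
  moreover have "u \<in> orbit" by (simp add: orbit_def)
  ultimately obtain v where v: "v \<in> orbit" and least: "\<And>w. w \<in> orbit \<Longrightarrow> (w, v) \<notin> ?lower"
    by (rule wfE_min) blast
  obtain q b where qb: "v = (q, b)" by (cases v)
  have to_u: "(w, u) \<in> (flow x)\<^sup>+" if "w \<in> orbit" for w
    using single_valued_cycle_absorbs[OF single_valued_flow subset_refl cycle] that by (simp add: orbit_def)
  have cycle_v: "(v, v) \<in> (flow x)\<^sup>+"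
    using trancl_rtrancl_trancl[OF to_u[OF v]] v by (simp add: orbit_def)
  have on: "on_tape x (snd w)" if w: "w \<in> orbit" for w
  proof -
    obtain w' where "(w, w') \<in> flow x" using tranclD[OF to_u[OF w]] by blast
    thus ?thesis by (cases w; cases w') (auto dest: flow_in_sites)
  qed
  have ge: "b \<le> snd w" if "w \<in> orbit" for w using least[OF that] on[OF that] on[OF v] by (simp add: qb) linarith
  have closed: "(w, w') \<in> flow_from x b \<and> w' \<in> orbit" if "w \<in> orbit" "(w, w') \<in> flow x" for w w'
  proof -
    have w': "w' \<in> orbit" using that by (auto simp: orbit_def)
    show ?thesis using that(2) ge[OF that(1)] ge[OF w'] w' by (auto simp: flow_from_def)
  qed
  have "((q, b), (q, b)) \<in> (flow_from x b)\<^sup>+"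
    using trancl_within[OF cycle_v v closed] by (simp only: qb)
  moreover have "state_rank q \<le> state_rank p" if "((q, b), (p, b)) \<in> (flow_from x b)\<^sup>+" for p
  proof -
    have "(v, (p, b)) \<in> (flow x)\<^sup>+" using trancl_mono[OF that flow_from_subset] by (simp add: qb)
    from trancl_within[OF this v closed] have "(p, b) \<in> orbit" by simp
    thus ?thesis using least[of "(p, b)"] by (simp add: qb)
  qed
  ultimately have "marked x v" using marked_iff[of b x q] on[OF v] by (simp add: qb)
  thus ?thesis using v unfolding orbit_def by blast
qed

lemma marked_unique:
  assumes "marked x u" "marked x v" and path: "(u, v) \<in> (flow x)\<^sup>*" and "on_tape x (snd u)" "on_tape x (snd v)"
  shows "u = v"
proof -
  obtain q b where u: "u = (q, b)" by (cases u)
  obtain p l where v: "v = (p, l)" by (cases v)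
  have mark_u: "(u, u) \<in> (flow_from x b)\<^sup>+" "\<And>p. (u, (p, b)) \<in> (flow_from x b)\<^sup>+ \<Longrightarrow> state_rank q \<le> state_rank p"
    using assms(1,4) marked_iff[of b x q] by (auto simp: u)
  have mark_v: "(v, v) \<in> (flow_from x l)\<^sup>+" "\<And>q. (v, (q, l)) \<in> (flow_from x l)\<^sup>+ \<Longrightarrow> state_rank p \<le> state_rank q"
    using assms(2,5) marked_iff[of l x p] by (auto simp: v)
  note absorbs = single_valued_cycle_absorbs[OF single_valued_flow flow_from_subset]
  have uv: "(u, v) \<in> (flow_from x b)\<^sup>+" "(v, u) \<in> (flow_from x b)\<^sup>+"
    using trancl_rtrancl_trancl[OF mark_u(1)] absorbs[OF mark_u(1) path] by blast+
  have "(v, u) \<in> (flow x)\<^sup>*" using trancl_mono[OF uv(2) flow_from_subset] by (rule trancl_into_rtrancl)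
  hence vu: "(v, u) \<in> (flow_from x l)\<^sup>+"
    using trancl_rtrancl_trancl[OF mark_v(1)] absorbs[OF mark_v(1)] by blast
  have "l = b" using flow_from_trancl_ge[OF uv(1)] flow_from_trancl_ge[OF vu] by (auto simp: u v)
  hence "state_rank q = state_rank p" using mark_u(2)[of p] mark_v(2)[of q] uv(1) vu by (auto simp: u v)
  moreover have "q \<in> Q" "p \<in> Q" using marked_at_trans assms(1,2) by (auto simp: u v)
  ultimately show ?thesis using \<open>l = b\<close> countable_finite[OF finite_states] by (simp add: u v state_rank_def)
qed

definition unmarked_flow :: "'a list \<Rightarrow> ('q \<times> int) rel" where
  "unmarked_flow x = {(u, v) \<in> flow x. \<not> marked x u}"

lemma finite_unmarked_flow: "finite (unmarked_flow x)"
  using finite_flow by (rule finite_subset[rotated]) (auto simp: unmarked_flow_def)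

lemma acyclic_unmarked_flow: "acyclic (unmarked_flow x)"
proof (rule acyclicI, intro allI notI)
  fix u assume cycle: "(u, u) \<in> (unmarked_flow x)\<^sup>+"
  have sub: "unmarked_flow x \<subseteq> flow x" by (auto simp: unmarked_flow_def)
  obtain v where v: "(u, v) \<in> (flow x)\<^sup>*" "marked x v" using marked_on_cycle trancl_mono[OF cycle sub] by blast
  have "(v, u) \<in> (unmarked_flow x)\<^sup>+"
    using single_valued_cycle_absorbs[OF single_valued_flow sub cycle v(1)] by simp
  thus False using v(2) by (auto simp: unmarked_flow_def dest: tranclD)
qed

lemma wf_unmarked_flow: "wf (unmarked_flow x)" "wf ((unmarked_flow x)\<inverse>)"
  using finite_unmarked_flow acyclic_unmarked_flow finite_acyclic_wf finite_acyclic_wf_converse by auto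

definition lap :: "'a list \<Rightarrow> 'q config rel" where
  "lap x = {(u, v) \<in> steps x. counter u \<noteq> 0 \<and> \<not> marked x (site u)}"

lemma lap_unmarked_flow: "(u, v) \<in> lap x \<Longrightarrow> (site u, site v) \<in> unmarked_flow x"
  using flow_of_step by (auto simp: lap_def unmarked_flow_def)

lemma wf_lap: "wf (lap x)" "wf ((lap x)\<inverse>)"
proof -
  have "lap x \<subseteq> inv_image (unmarked_flow x) site"
    using lap_unmarked_flow by (force simp: inv_image_def)
  thus "wf (lap x)" by (rule wf_subset[OF wf_inv_image[OF wf_unmarked_flow(1)]])
  have "(lap x)\<inverse> \<subseteq> inv_image ((unmarked_flow x)\<inverse>) site"
    using lap_unmarked_flow by (force simp: inv_image_def)
  thus "wf ((lap x)\<inverse>)" by (rule wf_subset[OF wf_inv_image[OF wf_unmarked_flow(2)]])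
qed

lemma single_valued_lap: "single_valued (lap x)"
  by (rule single_valued_subset[OF _ single_valued_step_rel]) (auto simp: lap_def)

lemma finite_lap_tree: "finite {u. (u, v) \<in> (lap x)\<^sup>*}"
proof (rule finite_rtrancl_preimage[OF wf_lap(1)])
  fix v
  have "{u. (u, v) \<in> lap x} \<subseteq> source v ` {..<num_moves}"
    using step_rel_source by (fastforce simp: lap_def)
  thus "finite {u. (u, v) \<in> lap x}" by (rule finite_subset) simp
qed

subsection \<open>The guarded machine\<close>

text \<open>The test before leaving a marked site tours the predecessors under \<open>lap\<close>, that is, back to the marked
  sites but not through them.\<close>

fun guarded :: "('q guard_state, 'a, 'q rel) local_trans" where
  "guarded (Run q) \<sigma> F z = (if \<not> z \<and> marked_at \<sigma> F q then Some (Test_Node False q 0, 0, 0)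
     else map_option (\<lambda>(p, c, d). (Run p, c, d)) (\<delta> q \<sigma> () z))"
| "guarded (Test_Node f q i) \<sigma> F z =
     (if i < num_moves then (case move_of i of (p, c, d) \<Rightarrow>
        if leaves_tape \<sigma> (- d) then Some (Test_Node f q (Suc i), 0, 0) else Some (Test_Try f q i, - c, - d))
      else if z then None
      else (case \<delta> q \<sigma> () False of None \<Rightarrow> None | Some (p, c, d) \<Rightarrow>
        if marked_at \<sigma> F q then (if f then Some (Run p, c, d) else None)
        else Some (Test_Node f p (Suc (move_index (q, c, d))), c, d)))"
| "guarded (Test_Try f q i) \<sigma> F z = (case move_of i of (p, c, d) \<Rightarrow>
     if leaves_tape \<sigma> d then None
     else if z then Some (Test_Node True q (Suc i), c, d)
     else if \<not> marked_at \<sigma> F p \<and> \<delta> p \<sigma> () False = Some (q, c, d) then Some (Test_Node f p 0, 0, 0)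
     else Some (Test_Node f q (Suc i), c, d))"

definition guard_states :: "'q guard_state set" where
  "guard_states = Run ` Q \<union> (\<lambda>(f, q, i). Test_Node f q i) ` (UNIV \<times> Q \<times> {..num_moves}) \<union>
     (\<lambda>(f, q, i). Test_Try f q i) ` (UNIV \<times> Q \<times> {..<num_moves})"

lemma mem_guard_states [simp]:
  "Run q \<in> guard_states \<longleftrightarrow> q \<in> Q"
  "Test_Node f q i \<in> guard_states \<longleftrightarrow> q \<in> Q \<and> i \<le> num_moves"
  "Test_Try f q i \<in> guard_states \<longleftrightarrow> q \<in> Q \<and> i < num_moves"
  by (auto simp: guard_states_def image_iff)

lemma guarded_legal:
  assumes "r \<in> guard_states" "guarded r \<sigma> F z = Some k"
  shows "k \<in> legal_moves guard_states \<sigma>"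
proof (cases r)
  case (Run q)
  show ?thesis
  proof (cases "\<not> z \<and> marked_at \<sigma> F q")
    case False
    then obtain p c d where "\<delta> q \<sigma> () z = Some (p, c, d)" "k = (Run p, c, d)" using assms Run by auto
    thus ?thesis using trans_legalD[of q \<sigma> "()" z p c d] assms(1) Run by (simp add: mem_legal_moves)
  qed (use assms Run in \<open>auto simp: mem_legal_moves incs_def leaves_tape_def\<close>)
next
  case (Test_Node f q i)
  show ?thesis
  proof (cases "i < num_moves")
    case True
    obtain p c d where move: "move_of i = (p, c, d)" by (cases "move_of i")
    show ?thesis using move_of_components[OF move] assms True move
      by (auto simp: Test_Node mem_legal_moves incs_def leaves_tape_def split: if_splits)
  next
    case False
    then obtain p c d where trans: "\<delta> q \<sigma> () False = Some (p, c, d)"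
      using assms Test_Node by (auto split: if_splits option.splits)
    have q: "q \<in> Q" using assms(1) Test_Node by simp
    show ?thesis using trans_legalD[OF q trans] trans_move_index(1)[OF q trans] assms trans False
      by (auto simp: Test_Node mem_legal_moves split: if_splits)
  qed
next
  case (Test_Try f q i)
  obtain p c d where move: "move_of i = (p, c, d)" by (cases "move_of i")
  show ?thesis using move_of_components[OF move] assms move
    by (auto simp: Test_Try mem_legal_moves incs_def leaves_tape_def split: if_splits)
qed

sublocale guard: local_machine guarded guard_states
  by unfold_locales (use finite_states guarded_legal in \<open>auto simp: guard_states_def\<close>)

abbreviation guard_steps :: "'a list \<Rightarrow> 'q guard_state config rel" where
  "guard_steps x \<equiv> step_rel guarded guard_states x (returns x)"

subsection \<open>The test succeeds if counter value 0 occurs\<close>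

inductive sees_zero :: "'a list \<Rightarrow> 'q config \<Rightarrow> bool" for x where
  zero: "i < num_moves \<Longrightarrow> on_tape x (position (source v i)) \<Longrightarrow> counter (source v i) = 0 \<Longrightarrow> sees_zero x v"
| child: "(u, v) \<in> lap x \<Longrightarrow> sees_zero x u \<Longrightarrow> sees_zero x v"

definition slot_sees_zero :: "'a list \<Rightarrow> 'q config \<Rightarrow> nat \<Rightarrow> bool" where
  "slot_sees_zero x v i \<longleftrightarrow> on_tape x (position (source v i)) \<and>
     (counter (source v i) = 0 \<or> (source v i, v) \<in> lap x \<and> sees_zero x (source v i))"

lemma sees_zero_slot:
  assumes "sees_zero x v"
  shows "\<exists>i<num_moves. slot_sees_zero x v i"
  using assms
proof (cases rule: sees_zero.cases)
  case (zero i)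
  thus ?thesis by (auto simp: slot_sees_zero_def)
next
  case (child u)
  have "(u, v) \<in> steps x" using child(1) by (simp add: lap_def)
  then obtain i where "i < num_moves" "u = source v i" using step_rel_source by blast
  moreover have "on_tape x (position u)"
    using step_rel_in_configs(1)[OF \<open>(u, v) \<in> steps x\<close>] by (auto simp: configs_def)
  ultimately show ?thesis using child by (auto simp: slot_sees_zero_def)
qed

abbreviation test_node :: "bool \<Rightarrow> 'q config \<Rightarrow> nat \<Rightarrow> 'q guard_state config" where
  "test_node f v i \<equiv> (Test_Node f (fst v) i, snd v)"

lemma lap_iff: "((p, a, b), v) \<in> lap x \<longleftrightarrow> a \<noteq> 0 \<and> \<not> marked x (p, b) \<and> p \<in> Q \<and> on_tape x b \<and>
    (\<exists>q c d. \<delta> p (letter_at x b) () False = Some (q, c, d) \<and> v = (q, a + c, b + d))"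
  by (auto simp: lap_def step_rel_iff)

lemma test_up:
  assumes "(u, v) \<in> lap x" "i < num_moves" "u = source v i"
  shows "(test_node f u num_moves, test_node f v (Suc i)) \<in> guard_steps x"
proof -
  obtain p c d where move: "move_of i = (p, c, d)" by (cases "move_of i")
  obtain q a b where v: "v = (q, a, b)" by (cases v)
  have u: "u = (p, a - c, b - d)" using assms(3) by (simp add: source_def move v)
  have "move_index (p, c, d) = i" using move_index_of[OF assms(2)] move by simp
  thus ?thesis using assms(1) by (auto simp: u v lap_iff step_rel_iff)
qed

lemma test_skip:
  assumes "q \<in> Q" "on_tape x b" "i < num_moves" "move_of i = (p, c, d)" and off: "\<not> on_tape x (b - d)"
  shows "((Test_Node f q i, a, b), (Test_Node f q (Suc i), a, b)) \<in> guard_steps x"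
proof -
  have "- d \<in> incs" using move_of_components[OF assms(4)] by (auto simp: incs_def)
  hence "leaves_tape (letter_at x b) (- d)" using leaves_tape_iff[OF assms(2)] off by simp
  thus ?thesis using assms by (simp add: step_rel_iff)
qed

lemma test_down:
  assumes "q \<in> Q" "on_tape x b" "i < num_moves" "move_of i = (p, c, d)" and on: "on_tape x (b - d)"
  shows "((Test_Node f q i, a, b), (Test_Try f q i, a - c, b - d)) \<in> guard_steps x"
proof -
  have "- d \<in> incs" using move_of_components[OF assms(4)] by (auto simp: incs_def)
  hence "\<not> leaves_tape (letter_at x b) (- d)" using leaves_tape_iff[OF assms(2)] on by simp
  thus ?thesis using assms by (simp add: step_rel_iff)
qed

lemma test_try:
  assumes "q \<in> Q" "on_tape x b" "i < num_moves" "move_of i = (p, c, d)" and on: "on_tape x (b - d)"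
  shows "((Test_Try f q i, a - c, b - d),
      if a = c then (Test_Node True q (Suc i), a, b)
      else if ((p, a - c, b - d), (q, a, b)) \<in> lap x then (Test_Node f p 0, a - c, b - d)
      else (Test_Node f q (Suc i), a, b)) \<in> guard_steps x"
proof -
  have p: "p \<in> Q" "d \<in> incs" using move_of_components[OF assms(4)] by auto
  hence "\<not> leaves_tape (letter_at x (b - d)) d" using leaves_tape_iff[OF on] assms(2) by simp
  thus ?thesis using assms p by (simp add: step_rel_iff lap_iff)
qed

lemma test_slot:
  assumes v: "v \<in> configs Q x" and i: "i < num_moves"
  shows "(\<exists>f'. (test_node f v i, test_node f' v (Suc i)) \<in> (guard_steps x)\<^sup>* \<and> (f \<or> slot_sees_zero x v i \<longrightarrow> f')) \<or>
    (\<exists>u\<in>configs Q x. (u, v) \<in> lap x \<and> (test_node f v i, test_node f u 0) \<in> (guard_steps x)\<^sup>* \<and>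
       (\<forall>f'. (test_node f' u num_moves, test_node f' v (Suc i)) \<in> (guard_steps x)\<^sup>*) \<and>
       (slot_sees_zero x v i \<longrightarrow> (\<exists>j<num_moves. slot_sees_zero x u j)))"
proof -
  obtain q a b where vq: "v = (q, a, b)" "q \<in> Q" "on_tape x b" using v by (cases v) (auto simp: mem_configs)
  obtain p c d where move: "move_of i = (p, c, d)" by (cases "move_of i")
  let ?u = "(p, a - c, b - d)"
  have source: "source v i = ?u" by (simp add: source_def move vq)
  hence slot: "slot_sees_zero x v i \<longleftrightarrow> on_tape x (b - d) \<and> (a = c \<or> (?u, v) \<in> lap x \<and> sees_zero x ?u)"
    by (simp add: slot_sees_zero_def)
  show ?thesis
  proof (cases "on_tape x (b - d)")
    case False
    have "(test_node f v i, test_node f v (Suc i)) \<in> guard_steps x"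
      using test_skip[OF vq(2,3) i move False] by (simp add: vq(1))
    thus ?thesis using False slot by blast
  next
    case True
    have down: "(test_node f v i, (Test_Try f q i, a - c, b - d)) \<in> guard_steps x"
      using test_down[OF vq(2,3) i move True] by (simp add: vq(1))
    show ?thesis
    proof (cases "a \<noteq> c \<and> (?u, v) \<in> lap x")
      case entered: True
      have "(test_node f v i, test_node f ?u 0) \<in> (guard_steps x)\<^sup>*"
        using down test_try[OF vq(2,3) i move True, of f a] entered vq(1) by (auto intro: rtrancl_into_rtrancl)
      moreover have "\<forall>f'. (test_node f' ?u num_moves, test_node f' v (Suc i)) \<in> (guard_steps x)\<^sup>*"
        using test_up[OF _ i source[symmetric]] entered by blast
      moreover have "slot_sees_zero x v i \<longrightarrow> (\<exists>j<num_moves. slot_sees_zero x ?u j)"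
        using entered slot sees_zero_slot[of x ?u] by blast
      moreover have "?u \<in> configs Q x" using True move_of_components[OF move] by (simp add: mem_configs)
      ultimately show ?thesis using entered by blast
    next
      case False
      hence "(test_node f v i, test_node (f \<or> a = c) v (Suc i)) \<in> (guard_steps x)\<^sup>*"
        using down test_try[OF vq(2,3) i move True, of f a] vq(1)
        by (cases "a = c") (auto intro: rtrancl_into_rtrancl)
      thus ?thesis using False slot by blast
    qed
  qed
qed

lemma test_completes:
  assumes "v \<in> configs Q x" "sees_zero x v"
  shows "(test_node False v 0, test_node True v num_moves) \<in> (guard_steps x)\<^sup>*"
proof -
  obtain f' where "(test_node False v 0, test_node f' v num_moves) \<in> (guard_steps x)\<^sup>*"
      "False \<or> (\<exists>j. 0 \<le> j \<and> j < num_moves \<and> slot_sees_zero x v j) \<longrightarrow> f'"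
    using subtree_tour[where node = test_node and hit = "slot_sees_zero x", OF _ assms(1) _ test_slot]
      wf_lap(1)[of x]
    by (metis wf_iff_acc zero_le)
  thus ?thesis using sees_zero_slot[OF assms(2)] by auto
qed

definition embed_run :: "'q config \<Rightarrow> 'q guard_state config" where
  "embed_run u = (Run (fst u), snd u)"

lemma embed_run_step:
  assumes "(u, v) \<in> steps x" and zero: "counter u \<noteq> 0 \<Longrightarrow> marked x (site u) \<Longrightarrow> sees_zero x u"
  shows "(embed_run u, embed_run v) \<in> (guard_steps x)\<^sup>*"
proof -
  obtain q a b p c d where u: "u = (q, a, b)" "v = (p, a + c, b + d)" "q \<in> Q" "on_tape x b"
    and trans: "\<delta> q (letter_at x b) () (a = 0) = Some (p, c, d)" using assms(1) by (rule step_relE)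
  show ?thesis
  proof (cases "a \<noteq> 0 \<and> marked x (q, b)")
    case True
    have "(embed_run u, test_node False u 0) \<in> guard_steps x"
      using True u by (simp add: step_rel_iff embed_run_def)
    moreover have "(test_node False u 0, test_node True u num_moves) \<in> (guard_steps x)\<^sup>*"
      using True u zero by (intro test_completes) (simp_all add: mem_configs)
    moreover have "(test_node True u num_moves, embed_run v) \<in> guard_steps x"
      using True u trans by (simp add: step_rel_iff embed_run_def)
    ultimately show ?thesis by (meson converse_rtrancl_into_rtrancl rtrancl_into_rtrancl)
  next
    case False
    hence "(embed_run u, embed_run v) \<in> guard_steps x" using u trans by (auto simp: step_rel_iff embed_run_def)
    thus ?thesis by simp
  qed
qed

subsection \<open>Halting runs pass all tests\<close>

definition shift :: "int \<Rightarrow> 'q config \<Rightarrow> 'q config" where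
  "shift D u = (fst u, counter u + D, position u)"

lemma steps_shift:
  "(u, v) \<in> steps x \<Longrightarrow> counter u \<noteq> 0 \<Longrightarrow> counter u + D \<noteq> 0 \<Longrightarrow> (shift D u, shift D v) \<in> steps x"
  by (auto elim!: step_relE simp: step_rel_iff shift_def)

lemma steps_counter_diff: "(u, v) \<in> steps x \<Longrightarrow> \<bar>counter v - counter u\<bar> \<le> 1"
  by (elim step_relE) (auto dest!: trans_legalD(2) simp: incs_def)

definition signed_steps :: "int \<Rightarrow> 'a list \<Rightarrow> 'q config rel" where
  "signed_steps e x = {(u, v) \<in> steps x. 0 < e * counter u}"

lemma signed_steps_subset: "(signed_steps e x)\<^sup>* \<subseteq> (steps x)\<^sup>*"
  by (rule rtrancl_mono) (auto simp: signed_steps_def)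

lemma signed_steps_flow: "(u, v) \<in> (signed_steps e x)\<^sup>* \<Longrightarrow> (site u, site v) \<in> (flow x)\<^sup>*"
proof (induction rule: rtrancl_induct)
  case (step v w)
  hence "(site v, site w) \<in> flow x" by (intro flow_of_step) (auto simp: signed_steps_def)
  with step(3) show ?case by (rule rtrancl_into_rtrancl)
qed simp

lemma no_ascending_cycle:
  assumes "(u, z) \<in> (steps x)\<^sup>*" "z \<notin> Domain (steps x)" "0 \<le> e * D"
  shows "(u, shift D u) \<notin> (signed_steps e x)\<^sup>+"
  using single_valued_stuck_terminates[OF single_valued_step_rel assms(1,2)]
proof (induction rule: acc_induct_rule)
  case (1 u)
  show ?case
  proof
    assume "(u, shift D u) \<in> (signed_steps e x)\<^sup>+"
    then obtain v where v: "(u, v) \<in> signed_steps e x" "(v, shift D u) \<in> (signed_steps e x)\<^sup>*"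
      by (meson tranclD)
    have pos: "0 < e * counter u" "0 < e * (counter u + D)"
      using v(1) assms(3) by (auto simp: signed_steps_def distrib_left)
    moreover have "(shift D u, shift D v) \<in> steps x"
      by (rule steps_shift) (use v(1) pos in \<open>auto simp: signed_steps_def\<close>)
    ultimately have "(shift D u, shift D v) \<in> signed_steps e x"
      by (simp add: signed_steps_def shift_def)
    with v(2) have "(v, shift D v) \<in> (signed_steps e x)\<^sup>+" by (rule rtrancl_into_trancl1)
    thus False using 1(2)[of v] v(1) by (auto simp: signed_steps_def)
  qed
qed

lemma run_since_last_zero:
  assumes "((q0, 0, 0), u) \<in> (steps x)\<^sup>*" "counter u \<noteq> 0"
  obtains e u0 u1 where "e \<in> {1, -1}" "counter u0 = 0" "(u0, u1) \<in> steps x"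
    "(u1, u) \<in> (signed_steps e x)\<^sup>*" "0 < e * counter u"
proof -
  have "\<exists>e u0 u1. e \<in> {1, -1} \<and> counter u0 = 0 \<and> (u0, u1) \<in> steps x \<and>
      (u1, u) \<in> (signed_steps e x)\<^sup>* \<and> 0 < e * counter u"
    using assms
  proof (induction rule: rtrancl_induct)
    case (step u v)
    show ?case
    proof (cases "counter u = 0")
      case True
      have "sgn (counter v) \<in> {1, -1}" "0 < sgn (counter v) * counter v"
        using step(4) by (auto simp: sgn_if)
      thus ?thesis using True step(2) by blast
    next
      case False
      then obtain e u0 u1 where e: "e \<in> {1, -1}" "counter u0 = 0" "(u0, u1) \<in> steps x"
        "(u1, u) \<in> (signed_steps e x)\<^sup>*" "0 < e * counter u" using step(3) by blast
      have "(u1, v) \<in> (signed_steps e x)\<^sup>*"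
        using e(4,5) step(2) by (auto simp: signed_steps_def intro: rtrancl_into_rtrancl)
      moreover have "0 < e * counter v" using e(1,5) step(4) steps_counter_diff[OF step(2)] by auto
      ultimately show ?thesis using e(1-3) by blast
    qed
  qed simp
  thus thesis using that by blast
qed

lemma sees_zero_shift:
  assumes e: "e \<in> {1, -1}" "e * D \<le> 0" and start: "counter u0 = 0" "(u0, u1) \<in> steps x"
    and path: "(u1, v) \<in> {(u, v) \<in> signed_steps e x. \<not> marked x (site u)}\<^sup>*" and pos: "0 < e * (counter v + D)"
  shows "sees_zero x (shift D v)"
proof -
  have crossing: "sees_zero x (shift D v)"
    if uv: "(u, v) \<in> steps x" and sign: "e * (counter u + D) \<le> 0" "0 < e * (counter v + D)" for u v
  proof -
    have "counter u + D = 0" using e(1) sign steps_counter_diff[OF uv] by auto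
    moreover obtain i where i: "i < num_moves" "u = source v i" using step_rel_source[OF uv] by blast
    moreover have "source (shift D v) i = shift D (source v i)"
      by (auto simp: source_def shift_def split: prod.splits)
    moreover have "on_tape x (position u)" using uv by (cases u) (auto simp: step_rel_iff)
    ultimately show ?thesis by (intro sees_zero.zero[of i]) (auto simp: shift_def)
  qed
  show ?thesis using path pos
  proof (induction rule: rtrancl_induct)
    case base
    show ?case using crossing[OF start(2)] start(1) e(2) base by simp
  next
    case (step u v)
    have uv: "(u, v) \<in> steps x" "0 < e * counter u" "\<not> marked x (site u)"
      using step(2) by (auto simp: signed_steps_def)
    show ?case
    proof (cases "0 < e * (counter u + D)")
      case True
      have "(shift D u, shift D v) \<in> steps x"
        by (rule steps_shift[OF uv(1)]) (use uv(2) True in auto)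
      hence "(shift D u, shift D v) \<in> lap x" using uv(3) True by (auto simp: lap_def shift_def)
      thus ?thesis using step(3)[OF True] by (rule sees_zero.child)
    qed (use crossing[OF uv(1)] step(4) in simp)
  qed
qed

text \<open>Let \<open>w\<close> be the first visit to the marked site of \<open>u\<close> since the counter was last 0. If the counter had
  moved away from 0 between \<open>w\<close> and \<open>u\<close>, the run would repeat this segment forever. Hence the path into
  \<open>w\<close>, shifted to the counter value of \<open>u\<close>, crosses 0.\<close>

lemma halting_run_sees_zero:
  assumes run: "((q0, 0, 0), u) \<in> (steps x)\<^sup>*" and halts: "(u, z) \<in> (steps x)\<^sup>*" "z \<notin> Domain (steps x)"
    and u: "counter u \<noteq> 0" "marked x (site u)"
  shows "sees_zero x u"
proof -
  obtain e u0 u1 where e: "e \<in> {1, -1}" and start: "counter u0 = 0" "(u0, u1) \<in> steps x"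
    and climb: "(u1, u) \<in> (signed_steps e x)\<^sup>*" "0 < e * counter u"
    using run_since_last_zero[OF run u(1)] .
  obtain w where w: "(u1, w) \<in> {(u, v) \<in> signed_steps e x. \<not> marked x (site u)}\<^sup>*" "marked x (site w)"
    "(w, u) \<in> (signed_steps e x)\<^sup>*"
    using rtrancl_first[OF climb(1), of "\<lambda>u. marked x (site u)"] u(2) by auto
  have "u1 \<in> configs Q x" using step_rel_in_configs(2)[OF start(2)] .
  moreover have "(u1, w) \<in> (steps x)\<^sup>*"
    by (rule subsetD[OF rtrancl_mono w(1)]) (auto simp: signed_steps_def)
  ultimately have "w \<in> configs Q x" by (rule step_rel_rtrancl_in_configs[rotated])
  hence "site w = site u"
    using marked_unique[OF w(2) u(2) signed_steps_flow[OF w(3)]] run_in_configs[OF run]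
    by (auto simp: configs_def)
  define D where "D = counter u - counter w"
  have shift: "u = shift D w" using \<open>site w = site u\<close> by (simp add: D_def shift_def prod_eq_iff)
  have "(w, z) \<in> (steps x)\<^sup>*" using signed_steps_subset w(3) halts(1) by (meson rtrancl_trans subsetD)
  have "e * D \<le> 0"
  proof (rule ccontr)
    assume ascending: "\<not> e * D \<le> 0"
    hence "w \<noteq> u" by (auto simp: D_def)
    hence "(w, shift D w) \<in> (signed_steps e x)\<^sup>+" using w(3) shift by (simp add: rtrancl_eq_or_trancl)
    thus False using no_ascending_cycle[OF \<open>(w, z) \<in> (steps x)\<^sup>*\<close> halts(2), of e D] ascending by simp
  qed
  moreover have "0 < e * (counter w + D)" using climb(2) by (simp add: D_def)
  ultimately show ?thesis using sees_zero_shift[OF e _ start w(1), of D] shift by simp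
qed

lemma embed_run_steps:
  assumes "((q0, 0, 0), u) \<in> (steps x)\<^sup>*" "u \<notin> Domain (steps x)"
  shows "(embed_run (q0, 0, 0), embed_run u) \<in> (guard_steps x)\<^sup>*"
proof -
  have "(embed_run (q0, 0, 0), embed_run v) \<in> (guard_steps x)\<^sup>*" if "((q0, 0, 0), v) \<in> (steps x)\<^sup>*" for v
    using that
  proof (induction rule: rtrancl_induct)
    case (step v w)
    have "(v, u) \<in> (steps x)\<^sup>*"
      using single_valued_rtrancl_stuck[OF single_valued_step_rel step(1) assms] .
    hence "(embed_run v, embed_run w) \<in> (guard_steps x)\<^sup>*"
      using embed_run_step[OF step(2)] halting_run_sees_zero[OF step(1) _ assms(2)] by blast
    with step(3) show ?case by (rule rtrancl_trans)
  qed simp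
  thus ?thesis using assms(1) .
qed

theorem decider_guarded: "decider guarded guard_states (Run q0) (Run ` A) (Run ` R) returns L"
proof unfold_locales
  show "guarded q \<sigma> \<beta> z = None" if final: "q \<in> Run ` A \<union> Run ` R" for q \<sigma> \<beta> z
  proof -
    obtain p where p: "q = Run p" "p \<in> A \<union> R" using final by auto
    have "\<not> marked_at \<sigma> \<beta> p" using marked_at_trans final_trans[OF p(2)] by blast
    thus ?thesis using p final_trans by simp
  qed
  show "\<exists>u. ((Run q0, 0, 0), u) \<in> (guard_steps x)\<^sup>* \<and> fst u \<in> (if x \<in> L then Run ` A else Run ` R)" for x
  proof -
    obtain u where u: "((q0, 0, 0), u) \<in> (steps x)\<^sup>*" "fst u \<in> (if x \<in> L then A else R)" using decides by blast
    have "u \<notin> Domain (steps x)" using final_stuck[of u x] u(2) by (auto split: if_splits)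
    thus ?thesis using embed_run_steps[OF u(1)] u(2)
      by (intro exI[of _ "embed_run u"]) (auto simp: embed_run_def)
  qed
qed (use init_state init_not_final accepting rejecting disjoint in auto)

subsection \<open>Halting configurations have finite predecessor trees\<close>

fun is_test :: "'q guard_state \<Rightarrow> bool" where
  "is_test (Run q) = False"
| "is_test (Test_Node f q i) = True"
| "is_test (Test_Try f q i) = True"

fun flagged :: "'q guard_state \<Rightarrow> bool" where
  "flagged (Run q) = False"
| "flagged (Test_Node f q i) = f"
| "flagged (Test_Try f q i) = f"

fun visited :: "'q guard_state config \<Rightarrow> 'q config" where
  "visited (Run q, a, b) = (q, a, b)"
| "visited (Test_Node f q i, a, b) = (q, a, b)"
| "visited (Test_Try f q i, a, b) = (case move_of i of (p, c, d) \<Rightarrow> (q, a + c, b + d))"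

lemma flagged_is_test: "flagged r \<Longrightarrow> is_test r"
  by (cases r) simp_all

lemma flagged_before: "(u, v) \<in> guard_steps x \<Longrightarrow> flagged (fst v) \<Longrightarrow> counter u \<noteq> 0 \<Longrightarrow> flagged (fst u)"
  by (cases u; cases "fst u") (auto simp: step_rel_iff split: prod.splits if_splits option.splits)

lemma test_exit_flagged: "(u, v) \<in> guard_steps x \<Longrightarrow> is_test (fst u) \<Longrightarrow> \<not> is_test (fst v) \<Longrightarrow> flagged (fst u)"
  by (cases u; cases "fst u") (auto simp: step_rel_iff split: prod.splits if_splits option.splits)

lemma run_step_unmarked:
  "(u, v) \<in> guard_steps x \<Longrightarrow> \<not> is_test (fst u) \<Longrightarrow> \<not> is_test (fst v) \<Longrightarrow> counter u \<noteq> 0 \<Longrightarrow>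
   (site (visited u), site (visited v)) \<in> unmarked_flow x"
  by (cases u; cases "fst u")
    (auto simp: step_rel_iff unmarked_flow_def flow_iff split: prod.splits if_splits option.splits)

lemma test_step_visited:
  assumes "(u, v) \<in> guard_steps x" "is_test (fst u)" "is_test (fst v)"
  shows "visited u = visited v \<or> (visited u, visited v) \<in> lap x \<or> (visited v, visited u) \<in> lap x"
proof -
  obtain r a b r' c d where u: "u = (r, a, b)" "v = (r', a + c, b + d)" "r \<in> guard_states" "on_tape x b"
    and trans: "guarded r (letter_at x b) (returns x b) (a = 0) = Some (r', c, d)"
    using assms(1) by (rule step_relE)
  show ?thesis
  proof (cases r)
    case (Test_Node f q i)
    show ?thesis using assms(3) u trans Test_Node
      by (cases "i < num_moves") (auto simp: lap_iff split: prod.splits if_splits option.splits)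
  next
    case (Test_Try f q i)
    obtain p e h where move: "move_of i = (p, e, h)" by (cases "move_of i")
    show ?thesis using assms(3) u trans Test_Try move move_of_components[OF move]
      by (auto simp: lap_iff split: if_splits)
  qed (use assms(2) u in simp)
qed

lemma visited_counter: "\<exists>c\<in>incs. counter w = counter (visited w) - c"
proof (cases w rule: visited.cases)
  case (3 f q i a b)
  obtain p c d where move: "move_of i = (p, c, d)" by (cases "move_of i")
  show ?thesis using 3 move move_of_components[OF move] by (intro bexI[of _ c]) auto
qed (auto simp: incs_def)

lemma finite_visited_in:
  assumes "finite X"
  shows "finite {w \<in> configs guard_states x. visited w \<in> X}"
proof (rule finite_subset)
  show "{w \<in> configs guard_states x. visited w \<in> X} \<subseteq>
      guard_states \<times> (\<lambda>(a, c). a - c) ` (counter ` X \<times> incs) \<times> {0..last_position x}"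
  proof
    fix w assume w: "w \<in> {w \<in> configs guard_states x. visited w \<in> X}"
    obtain c where "c \<in> incs" "counter w = counter (visited w) - c" using visited_counter by blast
    thus "w \<in> guard_states \<times> (\<lambda>(a, c). a - c) ` (counter ` X \<times> incs) \<times> {0..last_position x}"
      using w by (cases w) (force simp: configs_def)
  qed
  show "finite (guard_states \<times> (\<lambda>(a, c). a - c) ` (counter ` X \<times> incs) \<times> {0..last_position x})"
    using guard.finite_states assms by (simp add: incs_def)
qed

text \<open>A test does not leave the tree of the last \<open>lap\<close>-successor, which is finite.\<close>

lemma test_chain_not_inj:
  assumes chain: "\<And>i::nat. (F (Suc i), F i) \<in> guard_steps x" and test: "\<And>i. is_test (fst (F i))"
  shows "\<not> inj F"
proof
  assume "inj F"
  let ?forward = "{v. (visited (F 0), v) \<in> (lap x)\<^sup>*}"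
  have "visited (F 0) \<in> ?forward" by simp
  then obtain z where z: "z \<in> ?forward" "\<And>y. (y, z) \<in> (lap x)\<inverse> \<Longrightarrow> y \<notin> ?forward"
    by (rule wfE_min[OF wf_lap(2)]) blast
  have stuck: "z \<notin> Domain (lap x)" using z by (blast intro: rtrancl_into_rtrancl)
  have tree: "visited (F i) \<in> {u. (u, z) \<in> (lap x)\<^sup>*}" for i
  proof (induction i)
    case (Suc i)
    hence reach: "(visited (F i), z) \<in> (lap x)\<^sup>*" by simp
    have successor: "(v, z) \<in> (lap x)\<^sup>*" if "(visited (F i), v) \<in> lap x" for v
      using single_valued_rtrancl_stuck[OF single_valued_lap r_into_rtrancl[OF that] reach stuck] .
    consider "visited (F (Suc i)) = visited (F i)" | "(visited (F (Suc i)), visited (F i)) \<in> lap x"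
      | "(visited (F i), visited (F (Suc i))) \<in> lap x"
      using test_step_visited[OF chain[of i] test test] by blast
    thus ?case
    proof cases
      case 2
      thus ?thesis using reach by (simp add: converse_rtrancl_into_rtrancl)
    qed (use reach successor in simp_all)
  qed (use z(1) in blast)
  have "range F \<subseteq> {w \<in> configs guard_states x. visited w \<in> {u. (u, z) \<in> (lap x)\<^sup>*}}"
    using guard.step_rel_in_configs(2)[OF chain] tree by blast
  hence "finite (range F)" using finite_visited_in[OF finite_lap_tree] by (rule finite_subset)
  thus False using \<open>inj F\<close> finite_imageD infinite_UNIV_nat by blast
qed

text \<open>An infinite backward path eventually avoids counter value 0. From there on the flag of a test can no
  longer be raised, so no test is completed and the path would cycle without meeting a marked site.\<close>

lemma backward_chain_not_inj:
  assumes chain: "\<And>i::nat. (F (Suc i), F i) \<in> guard_steps x" and nonzero: "\<And>i. counter (F i) \<noteq> 0"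
  shows "\<not> inj F"
proof
  assume "inj F"
  have tail: "\<not> (\<forall>i. is_test (fst (F (n + i))))" for n
  proof
    assume "\<forall>i. is_test (fst (F (n + i)))"
    hence "\<not> inj (\<lambda>i. F (n + i))" using chain by (intro test_chain_not_inj) simp_all
    thus False by (auto simp: inj_def dest: injD[OF \<open>inj F\<close>])
  qed
  have "\<not> flagged (fst (F i))" for i
  proof
    assume "flagged (fst (F i))"
    hence "flagged (fst (F (i + j)))" for j
      using chain nonzero by (induction j) (auto intro: flagged_before)
    thus False using tail[of i] flagged_is_test by blast
  qed
  hence exit: "\<not> is_test (fst (F (Suc i)))" if "\<not> is_test (fst (F i))" for i
    using test_exit_flagged[OF chain] that by blast
  obtain n where n: "\<not> is_test (fst (F n))" using tail[of 0] by auto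
  have "\<not> is_test (fst (F (n + i)))" for i
    by (induction i) (use n exit in auto)
  hence descent: "(site (visited (F (n + Suc i))), site (visited (F (n + i)))) \<in> unmarked_flow x" for i
    using run_step_unmarked[OF chain _ _ nonzero, of "n + i"] by (metis add_Suc_right)
  show False
    by (rule wf_no_infinite_down_chainE[OF wf_unmarked_flow(1), of "\<lambda>i. site (visited (F (n + i)))" x])
      (use descent in blast)
qed

lemma stuck_acc:
  assumes "u \<notin> Domain (guard_steps x)"
  shows "u \<in> Wellfounded.acc (guard_steps x)"
proof (rule ccontr)
  assume "u \<notin> Wellfounded.acc (guard_steps x)"
  then obtain F where F: "F 0 = u" "\<And>i::nat. (F (Suc i), F i) \<in> guard_steps x"
    by (rule not_acc_backward_chain) (rule that)
  have "inj F"
    by (rule single_valued_backward_chain_inj[OF single_valued_step_rel]) (use assms F in auto)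
  have "finite (guard_states \<times> {0 :: int} \<times> {0..last_position x})" using guard.finite_states by simp
  hence "finite (F -` (guard_states \<times> {0} \<times> {0..last_position x}))" using \<open>inj F\<close> by (rule finite_vimageI)
  then obtain n where "\<And>i. F i \<in> guard_states \<times> {0} \<times> {0..last_position x} \<Longrightarrow> i < n"
    using finite_nat_set_iff_bounded by (metis vimageI2)
  moreover have "F i \<in> configs guard_states x" for i using guard.step_rel_in_configs(2)[OF F(2)] .
  ultimately have "counter (F (n + i)) \<noteq> 0" for i
    by (metis (no_types) configs_def mem_Times_iff not_add_less1 singletonI)
  hence "\<not> inj (\<lambda>i. F (n + i))" using F(2) by (intro backward_chain_not_inj) simp_all
  thus False by (auto simp: inj_def dest: injD[OF \<open>inj F\<close>])
qed

theorem tame_decider_guarded: "tame_decider guarded guard_states (Run q0) (Run ` A) (Run ` R) returns L"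
proof -
  interpret guard: decider guarded guard_states "Run q0" "Run ` A" "Run ` R" returns L
    by (rule decider_guarded)
  show ?thesis
  proof unfold_locales
    fix x
    obtain u where u: "((Run q0, 0, 0), u) \<in> (guard_steps x)\<^sup>*" "fst u \<in> Run ` A \<union> Run ` R"
      using guard.decides[of x] by (auto split: if_splits)
    have "u \<in> Wellfounded.acc (guard_steps x)" by (rule stuck_acc) (rule guard.final_stuck[OF u(2)])
    thus "\<exists>u. ((Run q0, 0, 0), u) \<in> (guard_steps x)\<^sup>* \<and> fst u \<in> Run ` A \<union> Run ` R \<and>
        u \<in> Wellfounded.acc (guard_steps x)" using u by blast
  qed
qed

theorem annotated_decider_guarded:
  "annotated_decider guarded guard_states (Run q0) (Run ` A) (Run ` R) returns L returns_left {} (Pow (Q \<times> Q))"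
proof (rule annotated_decider.intro[OF tame_decider_guarded], unfold_locales)
  show "finite (Pow (Q \<times> Q))" using finite_states by simp
  show "returns_left \<sigma> F \<in> Pow (Q \<times> Q)" for \<sigma> F using returns_left_subset by blast
qed (use returns_last returns_minus_one in auto)

end

section \<open>Removing the moves across the ends of the tape\<close>

text \<open>\<open>Ini\<close> is needed because the initial state of the given automaton may be a halting one, which counts
  only when it is entered again.\<close>

datatype 'q unwrapped_state = Ini | In 'q | Go_Left 'q | Go_Right 'q

locale recognizing_dca =
  fixes M :: "('q, 'a) dca" and L :: "'a list set"
  assumes valid: "valid_dca M" and recognizes: "dca_recognizes M L"
begin

definition zero_flag :: "bool \<Rightarrow> nat" where "zero_flag z = (if z then 0 else 1)"

definition unwrap :: "'a tsym \<Rightarrow> 'q \<times> int \<times> dir \<Rightarrow> 'q unwrapped_state \<times> int \<times> int" where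
  "unwrap \<sigma> = (\<lambda>(q, c, d). if \<sigma> = Dollar \<and> d = Rgt then (Go_Left q, c, -1)
     else if \<sigma> = Cent \<and> d = Lft then (Go_Right q, c, 1) else (In q, c, mu d))"

fun unwrapped :: "('q unwrapped_state, 'a, unit) local_trans" where
  "unwrapped Ini \<sigma> _ z = Some (unwrap \<sigma> (dtrans M (dinit M) \<sigma> (zero_flag z)))"
| "unwrapped (In q) \<sigma> _ z =
     (if q \<in> dacc M \<union> drej M then None else Some (unwrap \<sigma> (dtrans M q \<sigma> (zero_flag z))))"
| "unwrapped (Go_Left q) \<sigma> _ z = (if \<sigma> = Cent then Some (In q, 0, 0) else Some (Go_Left q, 0, -1))"
| "unwrapped (Go_Right q) \<sigma> _ z = (if \<sigma> = Dollar then Some (In q, 0, 0) else Some (Go_Right q, 0, 1))"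

definition unwrapped_states :: "'q unwrapped_state set" where
  "unwrapped_states = insert Ini (In ` dstates M \<union> Go_Left ` dstates M \<union> Go_Right ` dstates M)"

lemma mem_unwrapped_states [simp]:
  "Ini \<in> unwrapped_states" "In q \<in> unwrapped_states \<longleftrightarrow> q \<in> dstates M"
  "Go_Left q \<in> unwrapped_states \<longleftrightarrow> q \<in> dstates M" "Go_Right q \<in> unwrapped_states \<longleftrightarrow> q \<in> dstates M"
  by (auto simp: unwrapped_states_def)

lemma finite_dstates: "finite (dstates M)" and dinit_in: "dinit M \<in> dstates M"
  and dacc_subset: "dacc M \<subseteq> dstates M" and drej_subset: "drej M \<subseteq> dstates M"
  and dacc_drej_disjoint: "dacc M \<inter> drej M = {}"
  using valid by (auto simp: valid_dca_def)

lemma zero_flag_sgnc: "zero_flag (a = 0) = sgnc a"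
  by (simp add: zero_flag_def sgnc_def)

lemma dtrans_closed:
  assumes "q \<in> dstates M" "dtrans M q \<sigma> (zero_flag z) = (p, c, d)"
  shows "p \<in> dstates M" "c \<in> incs"
proof -
  have closed: "\<forall>q\<in>dstates M. \<forall>\<sigma> s. s \<in> {0, 1} \<longrightarrow> (case dtrans M q \<sigma> s of (p, c, d) \<Rightarrow> p \<in> dstates M \<and> c \<in> incs)"
    using valid unfolding valid_dca_def by (elim conjE)
  have "zero_flag z \<in> {0, 1}" by (simp add: zero_flag_def)
  from closed[rule_format, OF assms(1) this, of \<sigma>] show "p \<in> dstates M" "c \<in> incs"
    by (simp_all add: assms(2))
qed

lemma unwrap_legal:
  assumes "q \<in> dstates M"
  shows "unwrap \<sigma> (dtrans M q \<sigma> (zero_flag z)) \<in> legal_moves unwrapped_states \<sigma>"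
proof -
  obtain p c d where trans: "dtrans M q \<sigma> (zero_flag z) = (p, c, d)" by (cases "dtrans M q \<sigma> (zero_flag z)")
  show ?thesis using dtrans_closed[OF assms trans]
    by (cases d) (auto simp: trans unwrap_def mem_legal_moves incs_def leaves_tape_def)
qed

lemma unwrapped_legal:
  assumes "r \<in> unwrapped_states" "unwrapped r \<sigma> \<beta> z = Some k"
  shows "k \<in> legal_moves unwrapped_states \<sigma>"
  using assms dinit_in unwrap_legal
  by (cases r) (auto simp: mem_legal_moves incs_def leaves_tape_def split: if_splits)

abbreviation unwrapped_steps :: "'a list \<Rightarrow> 'q unwrapped_state config rel" where
  "unwrapped_steps x \<equiv> step_rel unwrapped unwrapped_states x (\<lambda>_. ())"

lemma walk_left:
  "k \<le> length x + 1 \<Longrightarrow> q \<in> dstates M \<Longrightarrow> ((Go_Left q, a, int k), (In q, a, 0)) \<in> (unwrapped_steps x)\<^sup>*"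
proof (induction k)
  case 0
  have "((Go_Left q, a, 0), (In q, a, 0)) \<in> unwrapped_steps x"
    using 0 letter_at_eq_Cent_iff[of 0 x] by (simp add: step_rel_iff)
  thus ?case by simp
next
  case (Suc k)
  have "((Go_Left q, a, int (Suc k)), (Go_Left q, a, int k)) \<in> unwrapped_steps x"
    using Suc.prems letter_at_eq_Cent_iff[of "int (Suc k)" x] by (simp add: step_rel_iff)
  thus ?case using Suc by (meson Suc_leD converse_rtrancl_into_rtrancl)
qed

lemma walk_right:
  "k \<le> length x + 1 \<Longrightarrow> q \<in> dstates M \<Longrightarrow>
   ((Go_Right q, a, last_position x - int k), (In q, a, last_position x)) \<in> (unwrapped_steps x)\<^sup>*"
proof (induction k)
  case 0
  have "((Go_Right q, a, last_position x), (In q, a, last_position x)) \<in> unwrapped_steps x"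
    using 0 letter_at_eq_Dollar_iff[of "last_position x" x] by (simp add: step_rel_iff)
  thus ?case by simp
next
  case (Suc k)
  have "((Go_Right q, a, last_position x - int (Suc k)), (Go_Right q, a, last_position x - int k))
      \<in> unwrapped_steps x"
    using Suc.prems letter_at_eq_Dollar_iff[of "last_position x - int (Suc k)" x] by (simp add: step_rel_iff)
  thus ?case using Suc by (meson Suc_leD converse_rtrancl_into_rtrancl)
qed

abbreviation lift :: "'q \<times> int \<times> nat \<Rightarrow> 'q unwrapped_state config" where
  "lift u \<equiv> (In (fst u), counter u, int (position u))"

lemma dstep_closed:
  assumes "fst u \<in> dstates M"
  shows "fst (dstep M x u) \<in> dstates M \<and> position (dstep M x u) \<le> length x + 1"
proof -
  obtain q a b where u: "u = (q, a, b)" by (cases u)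
  obtain p c d where trans: "dtrans M q (tape x b) (zero_flag (a = 0)) = (p, c, d)"
    by (cases "dtrans M q (tape x b) (zero_flag (a = 0))")
  show ?thesis using dtrans_closed(1)[OF _ trans] assms trans move_le[of x b "mu d"]
    by (simp add: u dstep_def zero_flag_sgnc)
qed

lemma wrapping_run:
  assumes p: "p \<in> dstates M" and b: "b \<le> length x + 1"
    and first: "unwrap (tape x b) (p, c, d) = (r, c', d')"
  shows "((r, a, int b + d'), (In p, a, int (move x b (mu d)))) \<in> (unwrapped_steps x)\<^sup>*"
proof -
  consider (right) "b = length x + 1" "d = Rgt" | (left) "b = 0" "d = Lft"
    | (inside) "\<not> (b = length x + 1 \<and> d = Rgt)" "\<not> (b = 0 \<and> d = Lft)" by blast
  thus ?thesis
  proof cases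
    case right
    hence "move x b (mu d) = 0" "(r, c', d') = (Go_Left p, c, -1)"
      using first by (simp_all add: move_def unwrap_def tape_def)
    thus ?thesis using walk_left[of "length x" x p a] p right by simp
  next
    case left
    hence "move x b (mu d) = length x + 1" "(r, c', d') = (Go_Right p, c, 1)"
      using first by (simp_all add: move_def unwrap_def tape_def zmod_minus1)
    thus ?thesis using walk_right[of "length x" x p a] p left by (simp add: add.commute)
  next
    case inside
    have "0 \<le> int b + mu d" "int b + mu d \<le> int (length x) + 1" using inside b by (cases d; auto)+
    hence "int (move x b (mu d)) = int b + mu d" by (simp add: move_def)
    moreover have "(r, c', d') = (In p, c, mu d)" using first inside
      by (auto simp: unwrap_def tape_def split: if_splits)
    ultimately show ?thesis by simp
  qed
qed

lemma unwrapped_simulates_dstep: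
  assumes state: "r = In (fst u) \<and> fst u \<notin> dacc M \<union> drej M \<or> r = Ini \<and> fst u = dinit M"
    and u: "fst u \<in> dstates M" "position u \<le> length x + 1"
  shows "((r, counter u, int (position u)), lift (dstep M x u)) \<in> (unwrapped_steps x)\<^sup>*"
proof -
  obtain q a b where qab: "u = (q, a, b)" by (cases u)
  obtain p c d where trans: "dtrans M q (tape x b) (zero_flag (a = 0)) = (p, c, d)"
    by (cases "dtrans M q (tape x b) (zero_flag (a = 0))")
  obtain r' c' d' where first: "unwrap (tape x b) (p, c, d) = (r', c', d')"
    by (cases "unwrap (tape x b) (p, c, d)")
  have "c' = c" using first by (auto simp: unwrap_def split: if_splits)
  have dstep: "dstep M x (q, a, b) = (p, a + c, move x b (mu d))"
    using trans by (simp add: dstep_def zero_flag_sgnc)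
  have "unwrapped r (letter_at x (int b)) () (a = 0) = Some (r', c, d')" "r \<in> unwrapped_states"
    using state u(1) trans first \<open>c' = c\<close> by (auto simp: qab letter_at_def dinit_in)
  hence "((r, a, int b), (r', a + c, int b + d')) \<in> unwrapped_steps x"
    using u(2) by (intro step_relI) (auto simp: qab)
  moreover have "p \<in> dstates M" using dtrans_closed(1)[OF _ trans] u(1) by (simp add: qab)
  hence "((r', a + c, int b + d'), lift (dstep M x u)) \<in> (unwrapped_steps x)\<^sup>*"
    using wrapping_run[OF _ _ first] u(2) by (simp add: qab dstep)
  ultimately show ?thesis by (simp add: qab converse_rtrancl_into_rtrancl)
qed

lemma dconf_closed: "fst (dconf M x t) \<in> dstates M \<and> position (dconf M x t) \<le> length x + 1"
  by (induction t) (use dinit_in dstep_closed in \<open>auto simp: dconf_def\<close>)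

lemma unwrapped_simulates_dconf:
  assumes "\<And>s. s \<le> t \<Longrightarrow> \<not> dhalted_at M x s"
  shows "((Ini, 0, 0), lift (dconf M x (Suc t))) \<in> (unwrapped_steps x)\<^sup>*"
  using assms
proof (induction t)
  case 0
  show ?case
    using unwrapped_simulates_dstep[of Ini "dconf M x 0" x] dconf_closed[of x 0] by (simp add: dconf_def)
next
  case (Suc t)
  have "((Ini, 0, 0), lift (dconf M x (Suc t))) \<in> (unwrapped_steps x)\<^sup>*" using Suc by simp
  also have "(lift (dconf M x (Suc t)), lift (dstep M x (dconf M x (Suc t)))) \<in> (unwrapped_steps x)\<^sup>*"
    using dconf_closed[of x "Suc t"] Suc.prems[of "Suc t"]
    by (intro unwrapped_simulates_dstep) (auto simp: dhalted_at_def)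
  finally show ?case by (simp add: dconf_def)
qed

lemma unwrapped_decides:
  "\<exists>u. ((Ini, 0, 0), u) \<in> (unwrapped_steps x)\<^sup>* \<and> fst u \<in> (if x \<in> L then In ` dacc M else In ` drej M)"
proof -
  define T where "T = (LEAST t. dhalted_at M x t)"
  have "\<exists>t. dhalted_at M x t" and accepts: "x \<in> L \<longleftrightarrow> fst (dconf M x T) \<in> dacc M"
    using recognizes by (auto simp: dca_recognizes_def T_def)
  hence halted: "dhalted_at M x T" by (auto simp: T_def intro: LeastI)
  then obtain t where t: "T = Suc t" by (cases T) (auto simp: dhalted_at_def)
  have "\<not> dhalted_at M x s" if "s \<le> t" for s
    using not_less_Least[of s "dhalted_at M x"] that t by (simp add: T_def)
  from unwrapped_simulates_dconf[OF this]
  have "((Ini, 0, 0), lift (dconf M x T)) \<in> (unwrapped_steps x)\<^sup>*" by (simp add: t)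
  moreover have "In (fst (dconf M x T)) \<in> (if x \<in> L then In ` dacc M else In ` drej M)"
    using halted accepts by (auto simp: dhalted_at_def)
  ultimately show ?thesis by (intro exI[of _ "lift (dconf M x T)"]) simp
qed

theorem decider_unwrapped: "decider unwrapped unwrapped_states Ini (In ` dacc M) (In ` drej M) (\<lambda>_ _. ()) L"
proof unfold_locales
  show "finite unwrapped_states" using finite_dstates by (simp add: unwrapped_states_def)
  show "In ` dacc M \<inter> In ` drej M = {}" using dacc_drej_disjoint by auto
qed (use dacc_subset drej_subset unwrapped_legal unwrapped_decides in auto)

end

theorem theorem12:
  fixes M :: "('q, 'a :: finite) dca" and L :: "'a list set"
  assumes "valid_dca M" and "dca_recognizes M L"
  shows "\<exists>M' :: (nat, 'a) qca. is_2R1CA M' \<and> is_simple M' \<and>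
           (\<forall>x. (x \<in> L \<longrightarrow> acc_step M' x sums 1) \<and> (x \<notin> L \<longrightarrow> rej_step M' x sums 1))"
proof -
  interpret dca: recognizing_dca M L
    using assms by unfold_locales
  interpret guard: cycle_guard dca.unwrapped dca.unwrapped_states Ini "In ` dacc M" "In ` drej M" L
    by (rule cycle_guard.intro) (rule dca.decider_unwrapped)
  interpret carrier: annotated_decider guard.guarded guard.guard_states "Run Ini"
    "Run ` In ` dacc M" "Run ` In ` drej M" guard.returns L guard.returns_left "{}" "Pow (dca.unwrapped_states \<times> dca.unwrapped_states)"
    by (rule guard.annotated_decider_guarded)
  interpret tour: reversible_tour carrier.carrier carrier.carrier_states To_End
    "carrier.carrier_final (Run ` In ` dacc M)" "carrier.carrier_final (Run ` In ` drej M)" L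
    by (rule reversible_tour.intro) (rule carrier.tame_decider_carrier)
  show ?thesis by (rule tour.simple_reversible_qca)
qed

end
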